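(* For all $n\ge 1$, the number $f^{123}_n$ of $123$-sortable permutations of length $n$ is $$f^{123}_n=1+\sum_{h=1}^{n-1}(n-h)\,\mathfrak{c}_h,$$ where $\mathfrak{c}_h=\frac{1}{h+1}\binom{2h}{h}$ is the $h$-th Catalan number.
   Context: For a permutation $\sigma$ of length at least $2$, the $\sigma$-stack acts on an input permutation $\pi=\pi_1\cdots\pi_n$ as follows (starting with empty stack and output). For $i=1,\dots,n$: as long as pushing $\pi_i$ on top of the stack would make the content of the stack, read from top to bottom, contain an occurrence of $\sigma$ (a subsequence order isomorphic to $\sigma$), pop the top element and append it to the output; then push $\pi_i$. After all letters have been pushed, pop all remaining elements, from top to bottom, appending them to the output. The resulting output is denoted $\mathcal{S}^{\sigma}(\pi)$. The permutation $\pi$ of length $n$ is $\sigma$-sortable if $\mathcal{S}^{21}(\mathcal{S}^{\sigma}(\pi))=12\cdots n$. *)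

theory Defs
  imports
    Complex_Main
    "HOL-Library.Sublist"
    "HOL-Combinatorics.Multiset_Permutations"
begin

text \<open>
  A permutation \<open>\<pi>\<^sub>1 \<dots> \<pi>\<^sub>n\<close> of length \<open>n\<close> is the list of its letters,
  i.e. an element of \<^term>\<open>permutations_of_set {1..n::nat}\<close>.
\<close>

definition order_isomorphic :: "nat list \<Rightarrow> nat list \<Rightarrow> bool" where
  "order_isomorphic xs ys \<longleftrightarrow>
     length xs = length ys \<and>
     (\<forall>i < length xs. \<forall>j < length xs. xs ! i < xs ! j \<longleftrightarrow> ys ! i < ys ! j)"

definition contains_pattern :: "nat list \<Rightarrow> nat list \<Rightarrow> bool" where
  "contains_pattern \<sigma> xs \<longleftrightarrow> (\<exists>ys. subseq ys xs \<and> order_isomorphic ys \<sigma>)"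

text \<open>
  The stack is a list whose head is the top, so that the list order is the order of reading
  from top to bottom. The functions \<open>pop_while\<close> and \<open>push_letter\<close> act on pairs (stack, output).
  When the stack is empty there is nothing left to pop; for patterns of length at least 2
  the letter can then always be pushed without creating an occurrence.
\<close>

fun pop_while :: "nat list \<Rightarrow> nat \<Rightarrow> nat list \<times> nat list \<Rightarrow> nat list \<times> nat list" where
  "pop_while \<sigma> x ([], out) = ([], out)"
| "pop_while \<sigma> x (t # st, out) =
     (if contains_pattern \<sigma> (x # t # st) then pop_while \<sigma> x (st, out @ [t]) else (t # st, out))"

definition push_letter :: "nat list \<Rightarrow> nat \<Rightarrow> nat list \<times> nat list \<Rightarrow> nat list \<times> nat list" where
  "push_letter \<sigma> x s = (case pop_while \<sigma> x s of (st, out) \<Rightarrow> (x # st, out))"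

definition stack_map :: "nat list \<Rightarrow> nat list \<Rightarrow> nat list" where
  "stack_map \<sigma> \<pi> = (case fold (push_letter \<sigma>) \<pi> ([], []) of (st, out) \<Rightarrow> out @ st)"

definition sortable :: "nat list \<Rightarrow> nat list \<Rightarrow> bool" where
  "sortable \<sigma> \<pi> \<longleftrightarrow> stack_map [2, 1] (stack_map \<sigma> \<pi>) = [1..<length \<pi> + 1]"

definition num_sortable :: "nat list \<Rightarrow> nat \<Rightarrow> nat" where
  "num_sortable \<sigma> n = card {\<pi> \<in> permutations_of_set {1..n}. sortable \<sigma> \<pi>}"

definition catalan :: "nat \<Rightarrow> real" where
  "catalan h = 1 / (real h + 1) * real ((2 * h) choose h)"

end

theory Submission
  imports Defs
begin

text \<open>
  Let \<open>k\<close> be the first letter of the input \<open>\<pi>\<close>; call a letter \<^emph>\<open>small\<close> if it is less than \<open>k\<close> and \<^emph>\<open>big\<close>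
  otherwise. A 21-stack sorts its input exactly if the input avoids 231, so \<open>\<pi>\<close> is sortable iff the
  output \<open>v\<close> of the 123-stack avoids 231. The theorem follows from a complete description of the
  sortable permutations with first letter \<open>k\<close>: for \<open>k = 1\<close> there is only the identity, and for
  \<open>k \<ge> 2\<close> they are the permutations
  \<open>\<pi> = k (k+1) \<dots> j A (k-1) (j+1) \<dots> n B\<close>,
  where \<open>k \<le> j \<le> n\<close> and \<open>\<tau> = A (k-1) B\<close> is a permutation of the small letters that avoids 213. There
  are \<open>n + 1 - k\<close> choices of \<open>j\<close> and \<open>catalan (k - 1)\<close> choices of \<open>\<tau>\<close>, and summing over
  \<open>h = k - 1\<close> gives the formula.

  \<^emph>\<open>Why the form is necessary.\<close> The first letter \<open>k\<close> stays at the bottom of the stack, so \<open>v\<close> ends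
  with \<open>k\<close>, and avoiding 231 forces the big letters to leave in decreasing order. Let \<open>k \<ge> 2\<close>. When the letter 1
  arrives, the stack is emptied down to a decreasing block of big letters, and 1 is never popped
  afterwards; hence everything that leaves before 1 leaves in decreasing order. So the small letters
  also decrease in \<open>v\<close>, and no big letter leaves between two small ones
  (\<open>block_decreasing_if_avoids\<close>). Now every nonempty sequence of pops ends with a small letter, while
  \<open>k - 1\<close> is the first small letter in \<open>v\<close>; so nothing is popped until a small letter arrives after
  \<open>k - 1\<close>. The stack is a subsequence of the output, which determines the order of all letters up
  to that moment. That small letter expels \<open>k - 1\<close>, so a big letter arriving still later would lie above
  some small letter and leave between \<open>k - 1\<close> and it (\<open>block_structure\<close>).

  \<^emph>\<open>Why it is sufficient.\<close> As long as the stack consists of small letters on top of a decreasing block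
  of big ones, the 123-stack treats the small letters as a 12-stack does, because any small letter and
  any big letter below it complete a 123 with every smaller letter.
  For an input of the above form the output is therefore
  \<open>n \<dots> (j+1)\<close>, then the output of the 12-stack on \<open>\<tau>\<close>, then \<open>j \<dots> k\<close> (\<open>emitted_block_form\<close>). The 12-stack
  puts \<open>\<tau>\<close> in decreasing order iff \<open>\<tau>\<close> avoids 213, which is the sorting theorem for the 21-stack with
  the order reversed.

  \<^emph>\<open>Counting.\<close> The 213-avoiding permutations are built by inserting the maximum at a place whose left
  side is increasing. Refining by the length of the increasing initial run gives the recurrence of the
  ballot numbers (\<open>av213_run_Suc\<close>), hence a difference of two binomial coefficients, which is the
  Catalan number when the run is unconstrained.
\<close>

section \<open>Patterns as subsequences\<close>

lemma contains_pattern_suffix: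
  "contains_pattern \<sigma> (x # zs) \<Longrightarrow> contains_pattern \<sigma> (x # ys @ zs)"
proof -
  assume "contains_pattern \<sigma> (x # zs)"
  then obtain w where w: "subseq w (x # zs)" "order_isomorphic w \<sigma>"
    by (auto simp: contains_pattern_def)
  have "subseq (x # zs) (x # ys @ zs)" by (simp add: subseq_drop_many)
  with w show ?thesis
    unfolding contains_pattern_def by (meson subseq_order.order_trans)
qed

lemma length_Suc_Suc_Suc_conv: "length ys = Suc (Suc (Suc 0)) \<longleftrightarrow> (\<exists>a b c. ys = [a, b, c])"
  by (auto simp: length_Suc_conv)

lemma length_Suc_Suc_conv: "length ys = Suc (Suc 0) \<longleftrightarrow> (\<exists>a b. ys = [a, b])"
  by (auto simp: length_Suc_conv)

lemma order_isomorphic_21: "order_isomorphic ys [2, 1] \<longleftrightarrow> (\<exists>a b. ys = [b, a] \<and> a < b)"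
proof
  assume iso: "order_isomorphic ys [2, 1]"
  then obtain b a where ys: "ys = [b, a]"
    by (auto simp: order_isomorphic_def length_Suc_Suc_conv)
  have "ys ! 1 < ys ! 0 \<longleftrightarrow> [2, 1::nat] ! 1 < [2, 1::nat] ! 0"
    using iso ys unfolding order_isomorphic_def by (metis length_Cons lessI zero_less_Suc One_nat_def list.size(3))
  with ys show "\<exists>a b. ys = [b, a] \<and> a < b" by simp
qed (auto simp: order_isomorphic_def less_Suc_eq nth_Cons' split: if_splits)

lemma order_isomorphic_123:
  "order_isomorphic ys [1, 2, 3] \<longleftrightarrow> (\<exists>a b c. ys = [a, b, c] \<and> a < b \<and> b < c)"
proof
  assume iso: "order_isomorphic ys [1, 2, 3]"
  then obtain a b c where ys: "ys = [a, b, c]"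
    by (auto simp: order_isomorphic_def length_Suc_Suc_Suc_conv)
  have "ys ! i < ys ! j \<longleftrightarrow> [1, 2, 3::nat] ! i < [1, 2, 3::nat] ! j" if "i < 3" "j < 3" for i j
    using iso ys that unfolding order_isomorphic_def by simp
  from this[of 0 1] this[of 1 2] ys show "\<exists>a b c. ys = [a, b, c] \<and> a < b \<and> b < c" by simp
qed (auto simp: order_isomorphic_def less_Suc_eq nth_Cons' split: if_splits)

lemma contains_21_iff: "contains_pattern [2, 1] xs \<longleftrightarrow> (\<exists>a b. subseq [b, a] xs \<and> a < b)"
  unfolding contains_pattern_def order_isomorphic_21 by blast

lemma contains_123_iff:
  "contains_pattern [1, 2, 3] xs \<longleftrightarrow> (\<exists>a b c. subseq [a, b, c] xs \<and> a < b \<and> b < c)"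
  unfolding contains_pattern_def order_isomorphic_123 by blast

lemma subseq_pair_Cons:
  "subseq [a, b] (x # xs) \<longleftrightarrow> a = x \<and> b \<in> set xs \<or> subseq [a, b] xs"
  by (auto simp: subseq_singleton_left dest: subseq_Cons')

lemma subseq_triple_Cons:
  "subseq [a, b, c] (x # xs) \<longleftrightarrow> a = x \<and> subseq [b, c] xs \<or> subseq [a, b, c] xs"
  by (auto dest: subseq_Cons')

lemma sorted_wrt_iff_subseq: "sorted_wrt P xs \<longleftrightarrow> (\<forall>a b. subseq [a, b] xs \<longrightarrow> P a b)"
proof (induction xs)
  case (Cons x xs)
  then show ?case unfolding subseq_pair_Cons by auto
qed simp

lemma subseq_sorted_wrt: "subseq xs ys \<Longrightarrow> sorted_wrt P ys \<Longrightarrow> sorted_wrt P xs"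
  unfolding sorted_wrt_iff_subseq by (meson subseq_order.order_trans)

lemma subseq_butlast_last: "xs \<noteq> [] \<Longrightarrow> a \<in> set xs \<Longrightarrow> a \<noteq> last xs \<Longrightarrow> subseq [a, last xs] xs"
  by (induction xs) (auto simp: subseq_singleton_left split: if_splits)

text \<open>
  This cuts an occurrence of a pattern back to a prefix of the word when its last letter is known to
  lie there.
\<close>

lemma subseq_snoc_drop_right:
  assumes "subseq (xs @ [a]) (ys @ zs)" "a \<notin> set zs"
  shows "subseq (xs @ [a]) ys"
proof -
  obtain p q where pq: "xs @ [a] = p @ q" "subseq p ys" "subseq q zs"
    using assms(1) by (auto simp: subseq_append_iff)
  have "q = []"
  proof (rule ccontr)
    assume "q \<noteq> []"
    then have "a \<in> set q" using pq(1) by (metis last_appendR last_in_set last_snoc)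
    then show False using pq(3) assms(2) by (metis subseq_order.order_trans subseq_singleton_left)
  qed
  with pq show ?thesis by simp
qed

lemma subseq_imp_mem: "subseq xs ys \<Longrightarrow> x \<in> set xs \<Longrightarrow> x \<in> set ys"
  using list_emb_set[of "(=)" xs ys x] by auto

section \<open>The machine as a recursive function\<close>

fun popped :: "nat list \<Rightarrow> nat \<Rightarrow> nat list \<Rightarrow> nat list" where
  "popped \<sigma> x [] = []"
| "popped \<sigma> x (t # st) = (if contains_pattern \<sigma> (x # t # st) then t # popped \<sigma> x st else [])"

fun kept :: "nat list \<Rightarrow> nat \<Rightarrow> nat list \<Rightarrow> nat list" where
  "kept \<sigma> x [] = []"
| "kept \<sigma> x (t # st) = (if contains_pattern \<sigma> (x # t # st) then kept \<sigma> x st else t # st)"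

text \<open>
  Everything that leaves the machine from now on, if the stack is \<open>st\<close> and the word \<open>w\<close> is still to
  be read. Leaving out the accumulated output makes induction on \<open>w\<close> direct.
\<close>

fun emitted :: "nat list \<Rightarrow> nat list \<Rightarrow> nat list \<Rightarrow> nat list" where
  "emitted \<sigma> st [] = st"
| "emitted \<sigma> st (x # w) = popped \<sigma> x st @ emitted \<sigma> (x # kept \<sigma> x st) w"

lemma pop_while_eq: "pop_while \<sigma> x (st, out) = (kept \<sigma> x st, out @ popped \<sigma> x st)"
  by (induction \<sigma> x "(st, out)" arbitrary: st out rule: pop_while.induct) auto

lemma push_letter_eq: "push_letter \<sigma> x (st, out) = (x # kept \<sigma> x st, out @ popped \<sigma> x st)"
  by (simp add: push_letter_def pop_while_eq)

lemma fold_push_letter: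
  "snd (fold (push_letter \<sigma>) w (st, out)) @ fst (fold (push_letter \<sigma>) w (st, out)) =
     out @ emitted \<sigma> st w"
  by (induction w arbitrary: st out) (simp_all add: push_letter_eq)

lemma stack_map_eq_emitted: "stack_map \<sigma> \<pi> = emitted \<sigma> [] \<pi>"
  using fold_push_letter[of \<sigma> \<pi> "[]" "[]"] by (simp add: stack_map_def split_beta)

lemma popped_append_kept: "popped \<sigma> x st @ kept \<sigma> x st = st"
  by (induction st) auto

lemma popped_Nil_imp_kept: "popped \<sigma> x st = [] \<Longrightarrow> kept \<sigma> x st = st"
  using popped_append_kept[of \<sigma> x st] by simp

text \<open>
  The machine pops as little as possible. Since containment is inherited from the lower part of the
  stack, it is enough to inspect the border of a proposed splitting: \<open>x\<close> may be pushed on \<open>K\<close>, but not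
  on \<open>K\<close> together with the letter just above it. Both
  \<open>popped_kept_21\<close> and \<open>popped_kept_123\<close> rest on this.
\<close>

lemma popped_kept_unique:
  assumes "K = [] \<or> \<not> contains_pattern \<sigma> (x # K)"
    and "P \<noteq> [] \<Longrightarrow> contains_pattern \<sigma> (x # last P # K)"
  shows "popped \<sigma> x (P @ K) = P \<and> kept \<sigma> x (P @ K) = K"
  using assms(2)
proof (induction P)
  case Nil
  then show ?case using assms(1) by (cases K) auto
next
  case (Cons p P)
  have "contains_pattern \<sigma> (x # p # P @ K)"
  proof (cases "P = []")
    case False
    have "contains_pattern \<sigma> (x # last P # K)" using Cons.prems False by simp
    then have "contains_pattern \<sigma> (x # (p # butlast P) @ last P # K)"
      by (rule contains_pattern_suffix)
    moreover have "(p # butlast P) @ last P # K = p # P @ K"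
      using False by (metis append_Cons append_Nil append_assoc append_butlast_last_id)
    ultimately show ?thesis by metis
  qed (use Cons.prems in simp)
  with Cons show ?case by (cases "P = []") auto
qed

lemma kept_avoids: "kept \<sigma> x st \<noteq> [] \<Longrightarrow> \<not> contains_pattern \<sigma> (x # kept \<sigma> x st)"
  by (induction st) auto

lemma last_popped_contains:
  "popped \<sigma> x st \<noteq> [] \<Longrightarrow> contains_pattern \<sigma> (x # last (popped \<sigma> x st) # kept \<sigma> x st)"
proof (induction st)
  case (Cons t st)
  then show ?case
    by (cases "popped \<sigma> x st = []") (use popped_append_kept[of \<sigma> x st] in \<open>auto split: if_splits\<close>)
qed simp

lemma mset_emitted: "mset (emitted \<sigma> st w) = mset st + mset w"
proof (induction w arbitrary: st)
  case (Cons x w)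
  then show ?case
    using arg_cong[OF popped_append_kept[of \<sigma> x st], of mset]
    by (simp add: algebra_simps flip: add.assoc)
qed simp

lemma set_emitted: "set (emitted \<sigma> st w) = set st \<union> set w"
  using mset_emitted[of \<sigma> st w] by (metis set_mset_mset set_mset_union)

lemma emitted_distinct:
  assumes "distinct \<pi>"
  shows "distinct (emitted \<sigma> [] \<pi>)" "set (emitted \<sigma> [] \<pi>) = set \<pi>"
proof -
  have "mset (emitted \<sigma> [] \<pi>) = mset \<pi>" by (simp add: mset_emitted)
  then show "distinct (emitted \<sigma> [] \<pi>)" "set (emitted \<sigma> [] \<pi>) = set \<pi>"
    using assms mset_eq_imp_distinct_iff mset_eq_setD by blast+
qed

text \<open>
  Letters in the stack leave from top to bottom, whatever arrives later. This is the main source of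
  information about the input when properties of the output are given.
\<close>

lemma stack_subseq_emitted: "subseq st (emitted \<sigma> st w)"
proof (induction w arbitrary: st)
  case (Cons x w)
  have "subseq (kept \<sigma> x st) (emitted \<sigma> (x # kept \<sigma> x st) w)"
    using Cons[of "x # kept \<sigma> x st"] by (rule subseq_Cons')
  then show ?case
    using list_emb_append_mono[OF subseq_order.refl[of "popped \<sigma> x st"]]
    by (metis emitted.simps(2) popped_append_kept)
qed simp

text \<open>
  Every intermediate stack is the lower part of \<open>rev u @ st\<close> and inherits its avoidance of \<open>\<sigma>\<close>.
\<close>

lemma emitted_no_pop:
  "\<not> contains_pattern \<sigma> (rev u @ st) \<Longrightarrow> emitted \<sigma> st (u @ w) = emitted \<sigma> (rev u @ st) w"
proof (induction u arbitrary: st)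
  case (Cons x u)
  have "\<not> contains_pattern \<sigma> (x # st)"
    using Cons.prems unfolding contains_pattern_def
    by (metis append_Cons append_assoc rev.simps(2) self_append_conv2 subseq_drop_many)
  then have "popped \<sigma> x st = []" "kept \<sigma> x st = st" by (cases st; simp)+
  then show ?case using Cons.IH[of "x # st"] Cons.prems by simp
qed simp

section \<open>Stacks that avoid a pattern of length two\<close>

text \<open>
  The 21-stack and the 12-stack, treated at once: for a strict linear order \<open>R\<close>, the letter \<open>x\<close> expels
  the letters that precede it in \<open>R\<close>. The 21-stack is the case \<open>R = (<)\<close>, the 12-stack the case
  \<open>R = (>)\<close>.
\<close>

fun sort_with :: "('a \<Rightarrow> 'a \<Rightarrow> bool) \<Rightarrow> 'a list \<Rightarrow> 'a list \<Rightarrow> 'a list" where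
  "sort_with R st [] = st"
| "sort_with R st (x # w) =
     takeWhile (\<lambda>t. R t x) st @ sort_with R (x # dropWhile (\<lambda>t. R t x) st) w"

text \<open>
  For \<open>R = (<)\<close> this is an occurrence of 231, for \<open>R = (>)\<close> an occurrence of 213.
\<close>

definition unsortable_triple :: "('a \<Rightarrow> 'a \<Rightarrow> bool) \<Rightarrow> 'a list \<Rightarrow> bool" where
  "unsortable_triple R w \<longleftrightarrow> (\<exists>a b c. subseq [b, c, a] w \<and> R a b \<and> R b c)"

lemma set_sort_with: "set (sort_with R st w) = set st \<union> set w"
proof (induction w arbitrary: st)
  case (Cons x w)
  have "set st = set (takeWhile (\<lambda>t. R t x) st) \<union> set (dropWhile (\<lambda>t. R t x) st)"
    by (metis set_append takeWhile_dropWhile_id)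
  then show ?case using Cons by auto
qed simp

lemma dropWhile_sorted_wrt:
  assumes "transp R" and "sorted_wrt R st" and "t \<in> set (dropWhile (\<lambda>t. R t x) st)"
  shows "\<not> R t x"
  using assms(2,3)
proof (induction st)
  case (Cons s st)
  show ?case
  proof (cases "R s x")
    case False
    then have "t = s \<or> R s t" using Cons.prems by auto
    then show ?thesis using False transpD[OF assms(1)] by blast
  qed (use Cons in auto)
qed simp

text \<open>
  Knuth's theorem on stack sorting. The letter \<open>x\<close> expels \<open>b\<close> with \<open>R b x\<close>; this is harmful exactly if
  some later letter \<open>a\<close> should have come out before \<open>b\<close>, and then \<open>b\<close>, \<open>x\<close>, \<open>a\<close> is a forbidden triple. For
  the induction, the letters that are already in the stack play the role of \<open>b\<close>.
\<close>

lemma sort_with_sorted_iff: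
  fixes R :: "'a \<Rightarrow> 'a \<Rightarrow> bool"
  assumes tr: "transp R" and irr: "irreflp R" and tot: "totalp R"
  assumes "sorted_wrt R st" and "distinct (st @ w)"
  shows "sorted_wrt R (sort_with R st w) \<longleftrightarrow>
    \<not> unsortable_triple R w \<and> (\<forall>b\<in>set st. \<forall>c a. subseq [c, a] w \<longrightarrow> \<not> (R a b \<and> R b c))"
  using assms(4,5)
proof (induction w arbitrary: st)
  case Nil
  then show ?case by (simp add: unsortable_triple_def)
next
  case (Cons x w)
  define P where "P = takeWhile (\<lambda>t. R t x) st"
  define K where "K = dropWhile (\<lambda>t. R t x) st"
  have st: "st = P @ K" by (simp add: P_def K_def)
  have P: "R t x" if "t \<in> set P" for t
    using that unfolding P_def by (auto dest: set_takeWhileD)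
  have K: "\<not> R t x" if "t \<in> set K" for t
    using dropWhile_sorted_wrt[OF tr Cons.prems(1)] that unfolding K_def by blast
  have K': "R x t" if "t \<in> set K" for t
    using K[OF that] tot Cons.prems(2) that unfolding st by (metis Un_iff distinct_append disjoint_iff list.set_intros(1) set_append totalpD)
  have asym: "\<not> (R a b \<and> R b a)" for a b
    using tr irr by (meson irreflpD transpD)
  have PK: "R p t" if "p \<in> set P" "t \<in> set K" for p t
    using Cons.prems(1) that by (simp add: st sorted_wrt_append)
  have sP: "sorted_wrt R P" and sK: "sorted_wrt R (x # K)"
    using Cons.prems(1) K' by (simp_all add: st sorted_wrt_append)
  have "distinct ((x # K) @ w)" using Cons.prems(2) by (auto simp: st)
  note IH = Cons.IH[OF sK this]
  have Pw: "R p a \<longleftrightarrow> \<not> R a p" if "p \<in> set P" "a \<in> set w" for p a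
    using tot asym Cons.prems(2) that unfolding st
    by (metis UnI1 UnI2 disjoint_iff distinct_append list.set_intros(2) set_append totalpD)
  have "sort_with R st (x # w) = P @ sort_with R (x # K) w"
    by (simp add: P_def K_def)
  then have 1: "sorted_wrt R (sort_with R st (x # w)) \<longleftrightarrow>
      sorted_wrt R (sort_with R (x # K) w) \<and> (\<forall>p\<in>set P. \<forall>a\<in>insert x (set K \<union> set w). R p a)"
    using sP by (auto simp only: sorted_wrt_append set_sort_with list.set Un_insert_left)
  have 2: "(\<forall>p\<in>set P. \<forall>a\<in>insert x (set K \<union> set w). R p a) \<longleftrightarrow> (\<forall>p\<in>set P. \<forall>a\<in>set w. \<not> R a p)"
    (is "?all \<longleftrightarrow> ?later")
  proof
    assume ?all
    then show ?later using asym by blast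
  next
    assume later: ?later
    show ?all
    proof (intro ballI)
      fix p a assume "p \<in> set P" "a \<in> insert x (set K \<union> set w)"
      then show "R p a" using P PK Pw later by auto
    qed
  qed
  have 3: "sorted_wrt R (sort_with R (x # K) w) \<and> (\<forall>p\<in>set P. \<forall>a\<in>set w. \<not> R a p) \<longleftrightarrow>
      \<not> unsortable_triple R (x # w) \<and>
      (\<forall>b\<in>set st. \<forall>c a. subseq [c, a] (x # w) \<longrightarrow> \<not> (R a b \<and> R b c))" (is "?L \<longleftrightarrow> ?R")
  proof
    assume L: ?L
    have w: "a \<in> set w" if "subseq [c, a] w" for c a
      using that by (meson subseq_Cons' subseq_singleton_left)
    have "\<not> (R a b \<and> R b c)" if "b \<in> set st" "subseq [c, a] (x # w)" for a b c
    proof (cases "b \<in> set P")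
      case True
      then show ?thesis using L w that(2) unfolding subseq_pair_Cons by blast
    next
      case False
      then have "b \<in> set K" using that(1) by (simp add: st)
      then show ?thesis using L IH K that(2) unfolding subseq_pair_Cons by (metis list.set_intros(2))
    qed
    moreover have "\<not> unsortable_triple R (x # w)"
    proof
      assume "unsortable_triple R (x # w)"
      then obtain a b c where abc: "subseq [b, c, a] (x # w)" "R a b" "R b c"
        unfolding unsortable_triple_def by blast
      have noR: "\<not> unsortable_triple R w" "\<forall>c a. subseq [c, a] w \<longrightarrow> \<not> (R a x \<and> R x c)"
        using L IH by (blast, simp)
      show False
        using abc noR unfolding unsortable_triple_def subseq_triple_Cons by blast
    qed
    ultimately show ?R by blast
  next
    assume R: ?R
    have "\<not> unsortable_triple R w"
      using R unfolding unsortable_triple_def subseq_triple_Cons by blast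
    moreover have "\<not> (R a b \<and> R b c)" if "b \<in> set (x # K)" "subseq [c, a] w" for a b c
    proof (cases "b = x")
      case True
      then show ?thesis using R that(2) unfolding unsortable_triple_def subseq_triple_Cons by blast
    next
      case False
      then show ?thesis using R that unfolding subseq_pair_Cons st by (metis UnI2 set_ConsD set_append)
    qed
    moreover have "\<not> R a p" if "p \<in> set P" "a \<in> set w" for p a
      using R P that unfolding subseq_pair_Cons st by (metis UnI1 set_append)
    ultimately show ?L using IH by blast
  qed
  show ?case unfolding 1 2 3 ..
qed

text \<open>
  Otherwise the simplifier turns the letter \<open>1\<close> of a pattern into \<open>Suc 0\<close>, and facts about the
  machine for the pattern \<open>[1, 2, 3]\<close> no longer match.
\<close>

declare One_nat_def [simp del]

lemma popped_kept_21:
  assumes "sorted_wrt (<) st"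
  shows "popped [2, 1] x st = takeWhile (\<lambda>t. t < x) st \<and> kept [2, 1] x st = dropWhile (\<lambda>t. t < x) st"
proof -
  define P K where "P = takeWhile (\<lambda>t. t < x) st" and "K = dropWhile (\<lambda>t. t < x) st"
  have st: "st = P @ K" by (simp add: P_def K_def)
  have K: "x \<le> t" if "t \<in> set K" for t
    using dropWhile_sorted_wrt[of "(<)" st t x] assms that by (auto simp: K_def)
  have sK: "sorted_wrt (<) K" using assms by (simp add: st sorted_wrt_append)
  have "\<not> contains_pattern [2, 1] (x # K)"
    using K sK unfolding contains_21_iff subseq_pair_Cons sorted_wrt_iff_subseq
    by (meson leD less_asym)
  moreover have "contains_pattern [2, 1] (x # last P # K)" if "P \<noteq> []"
  proof -
    have "last P < x" using last_in_set[OF that] unfolding P_def by (auto dest: set_takeWhileD)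
    then show ?thesis unfolding contains_21_iff subseq_pair_Cons by auto
  qed
  ultimately show ?thesis
    using popped_kept_unique[of K "[2, 1]" x P] st unfolding P_def K_def by metis
qed

lemma sorted_wrt_Cons_dropWhile:
  assumes "sorted_wrt R st" "transp R" "totalp R" "x \<notin> set st"
  shows "sorted_wrt R (x # dropWhile (\<lambda>t. R t x) st)"
proof -
  have "R x t" if "t \<in> set (dropWhile (\<lambda>t. R t x) st)" for t
    using dropWhile_sorted_wrt[OF assms(2,1) that] set_dropWhileD[OF that] assms(3,4)
    by (metis totalpD)
  then show ?thesis using assms(1) by (simp add: sorted_wrt_dropWhile)
qed

lemma emitted_21:
  "sorted_wrt (<) st \<Longrightarrow> distinct (st @ w) \<Longrightarrow> emitted [2, 1] st w = sort_with (<) st w"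
proof (induction w arbitrary: st)
  case (Cons x w)
  have "sorted_wrt (<) (x # dropWhile (\<lambda>t. t < x) st)"
    using sorted_wrt_Cons_dropWhile[of "(<)" st x] Cons.prems by simp
  moreover have "distinct ((x # dropWhile (\<lambda>t. t < x) st) @ w)"
    using Cons.prems by (auto dest: set_dropWhileD)
  ultimately show ?case
    using Cons.IH popped_kept_21[OF Cons.prems(1), of x] by simp
qed simp

lemma set_upt_Suc: "set [1..<n + 1] = {1..n}"
  unfolding set_upt by (metis Suc_eq_plus1 atLeastLessThanSuc_atLeastAtMost)

lemma sortable_iff:
  assumes "\<pi> \<in> permutations_of_set {1..n}"
  shows "sortable \<sigma> \<pi> \<longleftrightarrow> \<not> unsortable_triple (<) (emitted \<sigma> [] \<pi>)"
proof -
  define v where "v = emitted \<sigma> [] \<pi>"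
  have \<pi>: "set \<pi> = {1..n}" "distinct \<pi>" using assms by (auto simp: permutations_of_set_def)
  have len: "length \<pi> = n" using \<pi> distinct_card by fastforce
  have "mset v = mset \<pi>" by (simp add: v_def mset_emitted)
  then have v: "set v = {1..n}" "distinct v" using \<pi> by (metis mset_eq_setD, metis mset_eq_imp_distinct_iff)
  have sv: "set (sort_with (<) [] v) = {1..n}" using v by (simp add: set_sort_with)
  have "sort_with (<) [] v = [1..<n + 1] \<longleftrightarrow> sorted_wrt (<) (sort_with (<) [] v)"
  proof
    assume "sorted_wrt (<) (sort_with (<) [] v)"
    moreover have "set (sort_with (<) [] v) = set [1..<n + 1]" unfolding sv set_upt_Suc ..
    ultimately show "sort_with (<) [] v = [1..<n + 1]"
      using strict_sorted_equal sorted_wrt_upt by blast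
  qed simp
  also have "\<dots> \<longleftrightarrow> \<not> unsortable_triple (<) v"
    using sort_with_sorted_iff[of "(<)" "[]" v] v by simp
  finally show ?thesis
    using v by (simp add: sortable_def stack_map_eq_emitted len emitted_21 v_def)
qed

lemma unsortable_triple_subseq:
  assumes "\<not> unsortable_triple R v" "subseq u v"
  shows "\<not> unsortable_triple R u"
  using assms unfolding unsortable_triple_def by (meson subseq_order.order_trans)

lemma not_unsortable_triple_Nil [simp]: "\<not> unsortable_triple R []"
  by (simp add: unsortable_triple_def)

text \<open>
  A 231 starts with a letter that is exceeded by a later one, which no letter of \<open>X\<close> is.
\<close>

lemma not_unsortable_triple_decreasing_prefix:
  fixes X Z :: "nat list"
  assumes "sorted_wrt (>) X" "\<And>x z. x \<in> set X \<Longrightarrow> z \<in> set Z \<Longrightarrow> z < x"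
    and "\<not> unsortable_triple (<) Z"
  shows "\<not> unsortable_triple (<) (X @ Z)"
  using assms(1,2)
proof (induction X)
  case (Cons x X)
  have "c < x" if "subseq [c, a] (X @ Z)" for c a
    using subseq_imp_mem[OF that, of c] Cons.prems by auto
  then show ?case
    using Cons unfolding unsortable_triple_def append_Cons subseq_triple_Cons
    by (metis less_asym list.set_intros(2) sorted_wrt.simps(2))
qed (use assms(3) in simp)

text \<open>
  An ascent can only go from the block \<open>D\<close> to the block \<open>Z\<close>, and after that only letters of \<open>Z\<close> follow,
  all of them larger than the start of the ascent.
\<close>

lemma not_unsortable_triple_decreasing_blocks:
  fixes D Z :: "nat list"
  assumes "sorted_wrt (>) D" "\<And>x z. x \<in> set D \<Longrightarrow> z \<in> set Z \<Longrightarrow> x < z" "sorted_wrt (>) Z"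
  shows "\<not> unsortable_triple (<) (D @ Z)"
  using assms(1,2)
proof (induction D)
  case Nil
  show ?case
    using assms(3) not_unsortable_triple_decreasing_prefix[of Z "[]"] by simp
next
  case (Cons x D)
  have "\<not> (a < x \<and> x < c)" if ca: "subseq [c, a] (D @ Z)" for c a
  proof
    assume x: "a < x \<and> x < c"
    then have "c \<notin> set D" using Cons.prems by auto
    then have "subseq [c, a] Z"
      using ca by (induction D) (auto simp: subseq_pair_Cons split: if_splits)
    then have "a \<in> set Z" using subseq_imp_mem by fastforce
    then show False using Cons.prems(2)[of x a] x by simp
  qed
  moreover have "\<not> unsortable_triple (<) (D @ Z)" using Cons by simp
  ultimately show ?case
    unfolding unsortable_triple_def append_Cons subseq_triple_Cons by blast
qed

lemma sort_with_no_pop: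
  assumes "asymp R"
  shows "sorted_wrt R (rev u @ st) \<Longrightarrow> sort_with R st (u @ w) = sort_with R (rev u @ st) w"
proof (induction u arbitrary: st)
  case (Cons x u)
  then have "\<forall>t\<in>set st. R x t" by (simp add: sorted_wrt_append)
  then have "takeWhile (\<lambda>t. R t x) st = [] \<and> dropWhile (\<lambda>t. R t x) st = st"
    using assms by (cases st) (auto dest: asympD)
  then show ?case using Cons.IH[of "x # st"] Cons.prems by simp
qed simp

lemma sort_with_12_decreasing_iff:
  "distinct \<tau> \<Longrightarrow> sorted_wrt (>) (sort_with (>) [] \<tau>) \<longleftrightarrow> \<not> unsortable_triple (>) (\<tau> :: nat list)"
  using sort_with_sorted_iff[of "(>)" "[]" \<tau>] by (simp add: transp_def irreflp_def totalp_on_def)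

section \<open>The small letters above a large base\<close>

text \<open>
  A small letter \<open>s\<close> above the base together with any base letter completes a 123 with every letter
  \<open>x < s\<close>; so \<open>x\<close> must expel all letters of \<open>T\<close> that exceed it, and with them all that lies above,
  namely \<open>Y\<close>. After that, no ascent in the stack starts above \<open>x\<close>, and nothing else needs to go.
\<close>

lemma popped_kept_123:
  assumes "sorted_wrt (>) T" "sorted_wrt (>) base" "base \<noteq> []"
    and "\<And>s b. s \<in> insert x (set T) \<Longrightarrow> b \<in> set base \<Longrightarrow> s < b"
    and "Y = [] \<or> takeWhile (\<lambda>t. t > x) T \<noteq> []"
  shows "popped [1, 2, 3] x (Y @ T @ base) = Y @ takeWhile (\<lambda>t. t > x) T
       \<and> kept [1, 2, 3] x (Y @ T @ base) = dropWhile (\<lambda>t. t > x) T @ base"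
proof -
  define P K where "P = takeWhile (\<lambda>t. t > x) T" and "K = dropWhile (\<lambda>t. t > x) T"
  have T: "T = P @ K" by (simp add: P_def K_def)
  have K: "t \<le> x" if "t \<in> set K" for t
    using dropWhile_sorted_wrt[of "(>)" T t x] assms(1) that by (auto simp: K_def transp_def)
  have sK: "sorted_wrt (>) K" using assms(1) by (simp add: T sorted_wrt_append)
  have KB: "s < b" if "s \<in> set K" "b \<in> set base" for s b
    using assms(4) that by (simp add: T)
  \<comment> \<open>Ascents can only go from the small letters to the base, so two of them cannot be chained.\<close>
  have ascent: "a \<in> set K \<and> b \<in> set base" if ab: "subseq [a, b] (K @ base)" "a < b" for a b
  proof -
    have "\<not> subseq [a, b] K" "\<not> subseq [a, b] base"
      using sK assms(2) ab(2) unfolding sorted_wrt_iff_subseq by (meson less_asym)+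
    then show ?thesis
      using ab(1) by (auto simp: subseq_append_iff Cons_eq_append_conv subseq_singleton_left)
  qed
  have "\<not> contains_pattern [1, 2, 3] (x # K @ base)"
  proof
    assume "contains_pattern [1, 2, 3] (x # K @ base)"
    then obtain a b c where abc: "subseq [a, b, c] (x # K @ base)" "a < b" "b < c"
      unfolding contains_123_iff by blast
    then have "subseq [b, c] (K @ base)" unfolding subseq_triple_Cons by (meson subseq_Cons')
    then have b: "b \<in> set K" using ascent abc(3) by blast
    show False
    proof (cases "subseq [a, b, c] (K @ base)")
      case True
      then have "subseq [a, b] (K @ base)"
        by (meson subseq_order.order_trans subseq_Cons2 list_emb_Nil)
      then show False using ascent[OF _ abc(2)] KB b by blast
    next
      case False
      then have "a = x" using abc(1) unfolding subseq_triple_Cons by blast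
      then show False using K[OF b] abc(2) by simp
    qed
  qed
  moreover have "contains_pattern [1, 2, 3] (x # last (Y @ P) # K @ base)" if "Y @ P \<noteq> []"
  proof -
    have "P \<noteq> []" using that assms(5) by (auto simp: P_def)
    then have "last P \<in> set P" "last (Y @ P) = last P" by auto
    moreover have "x < last P" using calculation unfolding P_def by (auto dest: set_takeWhileD)
    moreover have "last P < hd base"
      using calculation assms(3,4) by (simp add: T)
    moreover have "subseq [hd base] (K @ base)"
      using assms(3) by (simp add: subseq_singleton_left)
    ultimately show ?thesis unfolding contains_123_iff by (metis subseq_Cons2)
  qed
  ultimately show ?thesis
    using popped_kept_unique[of "K @ base" "[1, 2, 3]" x "Y @ P"] T unfolding P_def[symmetric] K_def[symmetric]
    by (metis append_assoc)
qed

lemma emitted_123_small: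
  assumes "sorted_wrt (>) T" "distinct (T @ w)" "sorted_wrt (>) base" "base \<noteq> []"
    and "\<And>s b. s \<in> set (T @ w) \<Longrightarrow> b \<in> set base \<Longrightarrow> s < b"
  shows "emitted [1, 2, 3] (T @ base) w = sort_with (>) T w @ base"
  using assms(1,2,5)
proof (induction w arbitrary: T)
  case (Cons x w)
  define K where "K = dropWhile (\<lambda>t. t > x) T"
  have K: "set K \<subseteq> set T" "distinct K" using Cons.prems(2) by (auto simp: K_def dest: set_dropWhileD)
  have pk: "popped [1, 2, 3] x (T @ base) = takeWhile (\<lambda>t. t > x) T"
       "kept [1, 2, 3] x (T @ base) = K @ base"
    using popped_kept_123[OF Cons.prems(1) assms(3,4), of x "[]"] Cons.prems(3) by (auto simp: K_def)
  have "sorted_wrt (>) (x # K)"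
    using sorted_wrt_Cons_dropWhile[of "(>)" T x] Cons.prems(1,2)
    by (simp add: K_def transp_def totalp_on_def)
  then have "emitted [1, 2, 3] ((x # K) @ base) w = sort_with (>) (x # K) w @ base"
    using Cons.prems(2,3) K by (intro Cons.IH) auto
  then show ?case by (simp add: pk K_def)
qed simp

text \<open>
  The letters of \<open>Y\<close> stand for the big letters that arrive directly after the largest small letter, which
  is \<open>hd T\<close>: the next letter, if there is one, expels them together with \<open>hd T\<close>.
\<close>

lemma emitted_123_small_covered:
  assumes "sorted_wrt (>) T" "distinct (T @ w)" "sorted_wrt (>) base" "base \<noteq> []"
    and small: "\<And>s b. s \<in> set (T @ w) \<Longrightarrow> b \<in> set base \<Longrightarrow> s < b"
    and T: "T \<noteq> []" "\<And>x. x \<in> set w \<Longrightarrow> x < hd T"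
  shows "emitted [1, 2, 3] (Y @ T @ base) w = Y @ sort_with (>) T w @ base"
proof (cases w)
  case (Cons x w')
  have tw: "takeWhile (\<lambda>t. t > x) T \<noteq> []" using T Cons by (cases T) auto
  have s: "s < b" if "s \<in> insert x (set T)" "b \<in> set base" for s b
    using small that Cons by auto
  have "emitted [1, 2, 3] (Y @ T @ base) w = Y @ emitted [1, 2, 3] (T @ base) w"
    using popped_kept_123[OF assms(1,3,4) s, of x Y] popped_kept_123[OF assms(1,3,4) s, of x "[]"] tw
    by (simp add: Cons)
  also have "\<dots> = Y @ sort_with (>) T w @ base"
    using emitted_123_small[OF assms(1-4)] small by simp
  finally show ?thesis .
qed simp

section \<open>Intermediate states of the 123-machine\<close>

definition stack_after :: "nat list \<Rightarrow> nat list" where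
  "stack_after u = fst (fold (push_letter [1, 2, 3]) u ([], []))"

definition output_after :: "nat list \<Rightarrow> nat list" where
  "output_after u = snd (fold (push_letter [1, 2, 3]) u ([], []))"

lemma after_Nil [simp]: "stack_after [] = []" "output_after [] = []"
  by (simp_all add: stack_after_def output_after_def)

lemma after_snoc:
  "stack_after (u @ [x]) = x # kept [1, 2, 3] x (stack_after u)"
  "output_after (u @ [x]) = output_after u @ popped [1, 2, 3] x (stack_after u)"
proof -
  obtain st out where "fold (push_letter [1, 2, 3]) u ([], []) = (st, out)" by fastforce
  then show "stack_after (u @ [x]) = x # kept [1, 2, 3] x (stack_after u)"
    "output_after (u @ [x]) = output_after u @ popped [1, 2, 3] x (stack_after u)"
    by (simp_all add: stack_after_def output_after_def push_letter_eq)
qed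

lemma emitted_after: "emitted [1, 2, 3] [] (u @ w) = output_after u @ emitted [1, 2, 3] (stack_after u) w"
proof (induction u arbitrary: w rule: rev_induct)
  case (snoc x u)
  then show ?case using snoc[of "x # w"] by (simp add: after_snoc)
qed simp

lemma mset_after: "mset (output_after u) + mset (stack_after u) = mset u"
proof -
  have "mset (output_after u @ emitted [1, 2, 3] (stack_after u) []) = mset u"
    using emitted_after[of u "[]"] by (metis append_Nil2 mset_emitted mset.simps(1) add_0)
  then show ?thesis by simp
qed

lemma set_after: "set (output_after u) \<union> set (stack_after u) = set u"
  using mset_after[of u] by (metis set_mset_mset set_mset_union)

lemma distinct_stack_after: "distinct u \<Longrightarrow> distinct (stack_after u)"
  using mset_after[of u] by (metis distinct_append mset_append mset_eq_imp_distinct_iff)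

lemma after_subseq_emitted:
  "subseq (output_after u @ stack_after u) (emitted [1, 2, 3] [] (u @ w))"
  unfolding emitted_after by (simp add: stack_subseq_emitted subseq_append')

lemma stack_after_avoids: "\<not> contains_pattern [1, 2, 3] (stack_after u)"
proof (cases u rule: rev_cases)
  case Nil
  then show ?thesis by (simp add: contains_123_iff)
next
  case (snoc u' x)
  show ?thesis
  proof (cases "kept [1, 2, 3] x (stack_after u') = []")
    case True
    then show ?thesis by (auto simp: snoc after_snoc contains_123_iff)
  next
    case False
    then show ?thesis using kept_avoids by (simp add: snoc after_snoc)
  qed
qed

text \<open>
  The bottom letter of the stack is never popped, since no 123 consists of two letters only.
\<close>

lemma kept_123_nonempty:
  assumes "st \<noteq> []"
  shows "kept [1, 2, 3] x st \<noteq> []" and "last (kept [1, 2, 3] x st) = last st"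
proof -
  show *: "kept [1, 2, 3] x st \<noteq> []"
  proof
    assume e: "kept [1, 2, 3] x st = []"
    then have "popped [1, 2, 3] x st \<noteq> []" using popped_append_kept[of "[1,2,3]" x st] assms by auto
    from last_popped_contains[OF this] show False
      unfolding e contains_123_iff by (auto dest: list_emb_length split: if_splits)
  qed
  show "last (kept [1, 2, 3] x st) = last st"
    using popped_append_kept[of "[1,2,3]" x st] * by (metis last_appendR)
qed

lemma last_stack_after: "stack_after (x # u) \<noteq> [] \<and> last (stack_after (x # u)) = x"
proof (induction u rule: rev_induct)
  case Nil
  then show ?case using after_snoc(1)[of "[]" x] by simp
next
  case (snoc y u)
  then show ?case
    using after_snoc(1)[of "x # u" y] kept_123_nonempty[of "stack_after (x # u)" y] by simp
qed

lemma last_emitted: "last (emitted [1, 2, 3] [] (k # w)) = k"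
proof -
  have "emitted [1, 2, 3] [] (k # w) = output_after (k # w) @ stack_after (k # w)"
    using emitted_after[of "k # w" "[]"] by simp
  then show ?thesis using last_stack_after[of k w] by simp
qed

section \<open>What a decreasing output says about the input\<close>

text \<open>
  The consequences of avoiding 231 that determine the input. That they follow is shown in
  \<open>block_decreasing_if_avoids\<close> below.
\<close>

locale block_decreasing =
  fixes k :: nat and \<pi> :: "nat list"
  assumes distinct: "distinct \<pi>"
    and nonempty: "\<pi> \<noteq> []"
    and first: "hd \<pi> = k"
    and big_decreasing: "sorted_wrt (>) (filter (\<lambda>y. k \<le> y) (emitted [1, 2, 3] [] \<pi>))"
    and small_decreasing: "sorted_wrt (>) (filter (\<lambda>s. s < k) (emitted [1, 2, 3] [] \<pi>))"
    and no_big_between: "\<And>s y s'. subseq [s, y, s'] (emitted [1, 2, 3] [] \<pi>) \<Longrightarrow>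
          s < k \<Longrightarrow> s' < k \<Longrightarrow> y < k"
begin

abbreviation "v \<equiv> emitted [1, 2, 3] [] \<pi>"

lemma big_ascent: "subseq [a, b] v \<Longrightarrow> a < b \<Longrightarrow> a < k"
proof (rule ccontr)
  assume ab: "subseq [a, b] v" "a < b" "\<not> a < k"
  then have "subseq (filter (\<lambda>y. k \<le> y) [a, b]) (filter (\<lambda>y. k \<le> y) v)"
    by (blast intro: subseq_filter)
  then have "subseq [a, b] (filter (\<lambda>y. k \<le> y) v)" using ab by simp
  then have "b < a" using big_decreasing unfolding sorted_wrt_iff_subseq by blast
  then show False using ab by simp
qed

lemma small_ascent: "subseq [a, b] v \<Longrightarrow> a < b \<Longrightarrow> k \<le> b"
proof (rule ccontr)
  assume ab: "subseq [a, b] v" "a < b" "\<not> k \<le> b"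
  then have "subseq (filter (\<lambda>y. y < k) [a, b]) (filter (\<lambda>y. y < k) v)"
    by (blast intro: subseq_filter)
  then have "subseq [a, b] (filter (\<lambda>y. y < k) v)" using ab by simp
  then have "b < a" using small_decreasing unfolding sorted_wrt_iff_subseq by blast
  then show False using ab by simp
qed

text \<open>
  The last popped letter is the middle of a 123 whose largest letter lies below it in the stack. This
  pair is an ascent of the output, and by assumption big letters form no ascents.
\<close>

lemma last_popped_small:
  assumes "\<pi> = u @ w" and ne: "popped [1, 2, 3] x (stack_after u) \<noteq> []"
  shows "x < last (popped [1, 2, 3] x (stack_after u))"
    and "last (popped [1, 2, 3] x (stack_after u)) < k"
proof -
  define l K where "l = last (popped [1, 2, 3] x (stack_after u))"
    and "K = kept [1, 2, 3] x (stack_after u)"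
  have st: "stack_after u = butlast (popped [1, 2, 3] x (stack_after u)) @ l # K"
    using popped_append_kept[of "[1,2,3]" x "stack_after u"] ne
    by (metis K_def append_Cons append_Nil append_assoc append_butlast_last_id l_def)
  have sub: "subseq (l # K) (stack_after u)" by (subst st) (simp add: subseq_drop_many)
  obtain a b c where abc: "subseq [a, b, c] (x # l # K)" "a < b" "b < c"
    using last_popped_contains[OF ne] unfolding contains_123_iff l_def K_def by blast
  have "\<not> subseq [a, b, c] (l # K)"
    using sub stack_after_avoids abc(2,3) unfolding contains_123_iff
    by (meson subseq_order.order_trans)
  then have a: "a = x" "subseq [b, c] (l # K)" using abc(1) unfolding subseq_triple_Cons by blast+
  \<comment> \<open>The occurrence must use both \<open>x\<close> and \<open>l\<close>: without \<open>x\<close> it lies in the stack, without \<open>l\<close> it would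
     have caused a further pop.\<close>
  have "\<not> contains_pattern [1, 2, 3] (x # K)" if "K \<noteq> []"
    using kept_avoids that unfolding K_def by blast
  then have "\<not> subseq [b, c] K"
    using abc(2,3) a(1) unfolding contains_123_iff by (metis list_emb_Nil2 subseq_Cons2 list.distinct(1))
  then have "b = l" using a(2) unfolding subseq_pair_Cons by blast
  moreover have "subseq [l, c] v"
    using a(2) sub after_subseq_emitted[of u w] calculation assms(1)
    by (metis subseq_order.order_trans subseq_drop_many)
  ultimately show "x < last (popped [1, 2, 3] x (stack_after u))"
    and "last (popped [1, 2, 3] x (stack_after u)) < k"
    using big_ascent abc(2,3) a(1) unfolding l_def by auto
qed

lemma big_pops_nothing:
  assumes "\<pi> = u @ w" "k \<le> x"
  shows "popped [1, 2, 3] x (stack_after u) = []"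
  using last_popped_small[OF assms(1), of x] assms(2) by fastforce

text \<open>
  Otherwise a small letter would leave before \<open>k - 1\<close>.
\<close>

lemma pops_nothing_until_max_small:
  assumes \<pi>: "\<pi> = u @ x # w" and "k - 1 \<in> set (x # w)" "0 < k"
  shows "popped [1, 2, 3] x (stack_after u) = []"
proof (rule ccontr)
  assume ne: "popped [1, 2, 3] x (stack_after u) \<noteq> []"
  define l where "l = last (popped [1, 2, 3] x (stack_after u))"
  have l: "x < l" "l < k" using last_popped_small[OF \<pi> ne] by (auto simp: l_def)
  have "k - 1 \<in> set w" using assms(2) l by auto
  moreover have "l \<in> set (output_after (u @ [x]))"
    using ne by (simp add: after_snoc l_def)
  moreover have "v = output_after (u @ [x]) @ emitted [1, 2, 3] (stack_after (u @ [x])) w"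
    using emitted_after[of "u @ [x]" w] \<pi> by simp
  ultimately have "subseq ([l] @ [k - 1]) v"
    by (metis UnCI list_emb_append_mono set_emitted subseq_singleton_left)
  moreover have "l \<noteq> k - 1"
  proof
    assume "l = k - 1"
    then have "l \<in> set (u @ [x])" "l \<in> set w"
      using \<open>l \<in> set (output_after (u @ [x]))\<close> set_after[of "u @ [x]"] \<open>k - 1 \<in> set w\<close> by auto
    then show False using distinct \<pi> by auto
  qed
  ultimately have "subseq [l, k - 1] v" "l < k - 1" using l by auto
  then show False using small_ascent[of l "k - 1"] assms(3) by simp
qed

lemma state_before_max_small:
  assumes "\<pi> = u @ w" "k - 1 \<in> set w" "0 < k"
  shows "stack_after u = rev u \<and> output_after u = []"
  using assms(1,2)
proof (induction u arbitrary: w rule: rev_induct)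
  case (snoc x u)
  then have "stack_after u = rev u \<and> output_after u = []" by simp
  moreover have "popped [1, 2, 3] x (stack_after u) = []"
    using snoc.prems assms(3) by (intro pops_nothing_until_max_small[of u x w]) auto
  ultimately show ?case using popped_Nil_imp_kept by (simp add: after_snoc)
qed simp

lemma state_after_max_small:
  assumes "\<pi> = u @ (k - 1) # Y @ B" "0 < k" "\<And>y. y \<in> set Y \<Longrightarrow> k \<le> y"
  shows "stack_after (u @ (k - 1) # Y) = rev (u @ (k - 1) # Y) \<and> output_after (u @ (k - 1) # Y) = []"
  using assms(1,3)
proof (induction Y arbitrary: B rule: rev_induct)
  case Nil
  then have "popped [1, 2, 3] (k - 1) (stack_after u) = []"
    using assms(2) by (intro pops_nothing_until_max_small[of u "k - 1" B]) auto
  then show ?case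
    using state_before_max_small[of u "(k - 1) # B"] Nil assms(2) popped_Nil_imp_kept
    by (simp add: after_snoc)
next
  case (snoc y Y)
  then have "popped [1, 2, 3] y (stack_after (u @ (k - 1) # Y)) = []"
    by (intro big_pops_nothing[of _ "y # B"]) auto
  then show ?case
    using snoc after_snoc[of "u @ (k - 1) # Y" y] popped_Nil_imp_kept by simp
qed

text \<open>
  From \<open>k - 1\<close> on the stack always contains a small letter: a small letter is itself pushed, and a big
  one pops nothing. Further, a small letter expels \<open>k - 1\<close>, which together with \<open>k\<close> at the bottom would
  complete a 123.
\<close>

lemma small_present_after_max_small:
  assumes "\<pi> = u @ (k - 1) # w1 @ w2" "1 < k" "u \<noteq> []"
  shows "(\<exists>s\<in>set (stack_after (u @ (k - 1) # w1)). s < k) \<and>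
         ((\<exists>s\<in>set w1. s < k) \<longrightarrow> k - 1 \<notin> set (stack_after (u @ (k - 1) # w1)))"
  using assms(1)
proof (induction w1 arbitrary: w2 rule: rev_induct)
  case Nil
  then show ?case using state_after_max_small[of u "[]" w2] assms(2) by simp
next
  case (snoc x w1)
  define st where "st = stack_after (u @ (k - 1) # w1)"
  have IH: "(\<exists>s\<in>set st. s < k) \<and> ((\<exists>s\<in>set w1. s < k) \<longrightarrow> k - 1 \<notin> set st)"
    using snoc.IH[of "x # w2"] snoc.prems by (simp add: st_def)
  have st': "stack_after (u @ (k - 1) # w1 @ [x]) = x # kept [1, 2, 3] x st"
    using after_snoc(1)[of "u @ (k - 1) # w1" x] by (simp add: st_def)
  have x: "x \<noteq> k - 1" using distinct snoc.prems by auto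
  show ?case
  proof (cases "x < k")
    case True
    obtain u' where u: "u = k # u'"
      using first assms(1,3) by (cases u) auto
    have last: "st \<noteq> []" "last st = k"
      using last_stack_after[of k "u' @ (k - 1) # w1"] by (simp_all add: st_def u)
    note K = kept_123_nonempty[OF last(1), of x]
    have "k - 1 \<notin> set (kept [1, 2, 3] x st)"
    proof
      assume "k - 1 \<in> set (kept [1, 2, 3] x st)"
      then have "subseq [k - 1, k] (kept [1, 2, 3] x st)"
        using subseq_butlast_last[OF K(1), of "k - 1"] K(2) last(2) assms(2) by simp
      moreover have "x < k - 1" using x True by simp
      ultimately have "contains_pattern [1, 2, 3] (x # kept [1, 2, 3] x st)"
        unfolding contains_123_iff using assms(2)
        by (metis One_nat_def Suc_pred diff_less lessI less_imp_Suc_add subseq_Cons2 zero_less_Suc)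
      then show False using kept_avoids K(1) by blast
    qed
    then show ?thesis using True x by (auto simp: st')
  next
    case False
    have "popped [1, 2, 3] x st = []"
      unfolding st_def using snoc.prems False by (intro big_pops_nothing[of _ "x # w2"]) auto
    then show ?thesis using IH False x by (auto simp: st' popped_Nil_imp_kept)
  qed
qed

text \<open>
  If a small letter came between \<open>k - 1\<close> and the big letter \<open>y\<close>, then \<open>k - 1\<close> would have left, \<open>y\<close> would be
  pushed above some small letter \<open>t\<close>, and \<open>y\<close> would leave between the small letters \<open>k - 1\<close> and \<open>t\<close>.
\<close>

lemma big_directly_after_max_small:
  assumes \<pi>: "\<pi> = u @ (k - 1) # w1 @ y # w2" and k: "1 < k" and "u \<noteq> []" "k \<le> y" "s \<in> set w1"
  shows "k \<le> s"
proof (rule ccontr)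
  assume s: "\<not> k \<le> s"
  define p where "p = u @ (k - 1) # w1"
  have "\<exists>s\<in>set w1. s < k" using assms(5) s by (meson not_le)
  then have *: "\<exists>s\<in>set (stack_after p). s < k" "k - 1 \<notin> set (stack_after p)"
    using small_present_after_max_small[of u w1 "y # w2"] assms(1-3) unfolding p_def by auto
  have out: "k - 1 \<in> set (output_after p)" using *(2) set_after[of p] by (auto simp: p_def)
  obtain t where t: "t \<in> set (stack_after p)" "t < k" using *(1) by blast
  have "popped [1, 2, 3] y (stack_after p) = []"
    using \<pi> assms(4) by (intro big_pops_nothing[of _ "y # w2"]) (auto simp: p_def)
  then have "subseq (output_after p @ y # stack_after p) v"
    using after_subseq_emitted[of "p @ [y]" w2] \<pi> popped_Nil_imp_kept
    by (simp add: after_snoc) (simp add: p_def)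
  moreover have "subseq ([k - 1] @ [y, t]) (output_after p @ y # stack_after p)"
    using out t(1) by (intro list_emb_append_mono) (auto simp: subseq_singleton_left)
  ultimately have "subseq [k - 1, y, t] v" by (metis append_Cons append_Nil subseq_order.order_trans)
  then show False using no_big_between t(2) k assms(4) by (metis diff_less leD less_trans zero_less_one)
qed

text \<open>
  At the time when all of \<open>C\<close>, \<open>A\<close>, \<open>k - 1\<close>, \<open>Y\<close> have been read and nothing has been popped, the stack is the
  reversal of what was read and a subsequence of the output. The monotonicity of the big and of the
  small letters in the output then becomes monotonicity of \<open>C Y\<close> and of \<open>A\<close>, and a big letter after a
  letter of \<open>A\<close> would leave between \<open>k - 1\<close> and that letter.
\<close>

lemma block_structure:
  assumes k: "1 < k" "k - 1 \<in> set \<pi>"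
  obtains C A Y B where
    "\<pi> = C @ A @ (k - 1) # Y @ B" "C \<noteq> []"
    "\<forall>y\<in>set C \<union> set Y. k \<le> y" "\<forall>s\<in>set A \<union> set B. s < k"
    "sorted_wrt (<) (C @ Y)" "sorted_wrt (<) A"
proof -
  obtain u w where \<pi>: "\<pi> = u @ (k - 1) # w" using k(2) by (meson split_list)
  obtain u' where u: "u = k # u'" using first k(1) \<pi> by (cases u) auto
  define C A Y B where "C = takeWhile (\<lambda>y. k \<le> y) u" and "A = dropWhile (\<lambda>y. k \<le> y) u"
    and "Y = takeWhile (\<lambda>y. k \<le> y) w" and "B = dropWhile (\<lambda>y. k \<le> y) w"
  have uw: "u = C @ A" "w = Y @ B" by (simp_all add: C_def A_def Y_def B_def)
  have CY: "\<forall>y\<in>set C \<union> set Y. k \<le> y" by (auto simp: C_def Y_def dest: set_takeWhileD)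
  have "C \<noteq> []" by (simp add: C_def u)
  have Bs: "s < k" if sin: "s \<in> set B" for s
  proof (rule ccontr)
    assume s: "\<not> s < k"
    then obtain b B' where B: "B = b # B'" using sin by (cases B) auto
    have b: "b < k" using hd_dropWhile[of "\<lambda>y. k \<le> y" w] B unfolding B_def
      by (metis list.sel(1) list.distinct(1) not_le)
    then have "s \<in> set B'" using sin s B b by auto
    then obtain p q where "B' = p @ s # q" by (meson split_list)
    then have "\<pi> = u @ (k - 1) # (Y @ b # p) @ s # q" using \<pi> uw B by simp
    from big_directly_after_max_small[OF this k(1), of b] s b show False by (simp add: u)
  qed
  have "subseq (stack_after (u @ (k - 1) # Y)) v"
    using after_subseq_emitted[of "u @ (k - 1) # Y" B] \<pi> uw(2) 
    by (metis append_Cons append_assoc subseq_order.order_trans subseq_drop_many subseq_order.refl)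
  then have sub: "subseq (rev Y @ (k - 1) # rev A @ rev C) v"
    using state_after_max_small[of u Y B] \<pi> uw k(1) CY by simp
  have As: "s < k" if sin: "s \<in> set A" for s
  proof (rule ccontr)
    assume s: "\<not> s < k"
    then obtain a A' where A: "A = a # A'" using sin by (cases A) auto
    have a: "a < k" using hd_dropWhile[of "\<lambda>y. k \<le> y" u] A unfolding A_def
      by (metis list.sel(1) list.distinct(1) not_le)
    then have "s \<in> set (rev A')" using sin s A a by auto
    then have "subseq ([s] @ [a]) (rev A' @ [a])"
      by (intro list_emb_append_mono) (simp_all add: subseq_singleton_left)
    then have "subseq [k - 1, s, a] (rev Y @ (k - 1) # rev A @ rev C)"
      using A subseq_rev_drop_many[of "[s, a]" "rev A' @ [a]" "rev C"]
      by (intro subseq_drop_many) simp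
    then have "subseq [k - 1, s, a] v" using sub by (meson subseq_order.order_trans)
    then show False using no_big_between[of "k - 1" s a] a s k(1) by simp
  qed
  have filters:
    "filter (\<lambda>y. k \<le> y) C = C" "filter (\<lambda>y. k \<le> y) Y = Y" "filter (\<lambda>y. k \<le> y) A = []"
    "filter (\<lambda>y. y < k) C = []" "filter (\<lambda>y. y < k) Y = []" "filter (\<lambda>y. y < k) A = A"
    using CY As unfolding filter_id_conv filter_empty_conv by (meson UnCI leD)+
  have "sorted_wrt (>) (filter (\<lambda>y. k \<le> y) (rev Y @ (k - 1) # rev A @ rev C))"
    using subseq_sorted_wrt[OF subseq_filter[OF sub] big_decreasing] .
  moreover have "filter (\<lambda>y. k \<le> y) (rev Y @ (k - 1) # rev A @ rev C) = rev (C @ Y)"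
    using k(1) by (simp add: filters flip: rev_filter)
  ultimately have "sorted_wrt (>) (rev (C @ Y))" by simp
  then have "sorted_wrt (<) (C @ Y)" by (simp only: sorted_wrt_rev)
  have "sorted_wrt (>) (filter (\<lambda>y. y < k) (rev Y @ (k - 1) # rev A @ rev C))"
    using subseq_sorted_wrt[OF subseq_filter[OF sub] small_decreasing] .
  moreover have "filter (\<lambda>y. y < k) (rev Y @ (k - 1) # rev A @ rev C) = (k - 1) # rev A"
    using k(1) by (simp add: filters flip: rev_filter)
  ultimately have "sorted_wrt (>) (rev A)" by simp
  then have "sorted_wrt (<) A" by (simp only: sorted_wrt_rev)
  have "\<forall>s\<in>set A \<union> set B. s < k" using As Bs by blast
  then show ?thesis
    using that[of C A Y B] \<pi> uw \<open>C \<noteq> []\<close> CY \<open>sorted_wrt (<) (C @ Y)\<close> \<open>sorted_wrt (<) A\<close>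
    by simp
qed

end

section \<open>Outputs that avoid 231\<close>

text \<open>
  Once the letter 1 lies on a decreasing stack it is not popped any more: it is too small to be the
  middle of a 123, and below it there are no ascents.
\<close>

lemma emitted_bottom:
  assumes "sorted_wrt (>) K" "\<And>x. x \<in> set K \<union> set w \<Longrightarrow> 1 \<le> x"
  shows "\<exists>W. emitted [1, 2, 3] (X @ 1 # K) w = W @ 1 # K"
  using assms(2)
proof (induction w arbitrary: X)
  case (Cons x w)
  have avoids: "\<not> contains_pattern [1, 2, 3] (x # 1 # K)"
  proof
    assume "contains_pattern [1, 2, 3] (x # 1 # K)"
    then obtain a b c where abc: "subseq [a, b, c] (x # 1 # K)" "a < b" "b < c"
      unfolding contains_123_iff by blast
    then have "subseq [b, c] (1 # K)"
      unfolding subseq_triple_Cons[of a b c x "1 # K"] by (blast dest: subseq_Cons')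
    moreover have "\<not> subseq [b, c] K"
      using assms(1) abc(3) unfolding sorted_wrt_iff_subseq by (meson less_asym)
    ultimately have "b = 1" unfolding subseq_pair_Cons by blast
    moreover have "a \<in> set (x # 1 # K)" using list_emb_set[OF abc(1), of a] by auto
    then have "1 \<le> a" using Cons.prems by auto
    ultimately show False using abc(2) by simp
  qed
  have "\<exists>X'. kept [1, 2, 3] x (X @ 1 # K) = X' @ 1 # K"
  proof (induction X)
    case Nil
    show ?case using avoids by auto
  next
    case (Cons t X)
    show ?case
    proof (cases "contains_pattern [1, 2, 3] (x # t # X @ 1 # K)")
      case True
      then show ?thesis using Cons by simp
    next
      case False
      then show ?thesis by (metis append_Cons kept.simps(2))
    qed
  qed
  then obtain X' where X': "kept [1, 2, 3] x (X @ 1 # K) = X' @ 1 # K" by blast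
  obtain W where "emitted [1, 2, 3] ((x # X') @ 1 # K) w = W @ 1 # K"
    using Cons.IH[of "x # X'"] Cons.prems by auto
  then show ?case by (simp add: X')
qed auto

text \<open>
  An ascent before the least letter forms a 231 with it.
\<close>

lemma sorted_wrt_before_least:
  fixes W :: "nat list"
  assumes "\<not> unsortable_triple (<) (W @ l # Z)" "distinct W" "\<And>x. x \<in> set W \<Longrightarrow> l < x"
  shows "sorted_wrt (>) W"
  unfolding sorted_wrt_iff_subseq
proof (intro allI impI)
  fix a b assume ab: "subseq [a, b] W"
  have "subseq ([a, b] @ [l]) (W @ l # Z)" using ab by (intro list_emb_append_mono) auto
  then have "\<not> a < b"
    using assms(1,3) subseq_imp_mem[OF ab, of a] unfolding unsortable_triple_def by auto
  moreover have "a \<noteq> b" using subseqs_distinctD[of "[a, b]" W] ab assms(2) by auto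
  ultimately show "a > b" by simp
qed

text \<open>
  The big letters are handled with the final letter \<open>k\<close> of the output. If \<open>k = 1\<close>, there are no small
  letters; otherwise they are handled with the letter 1, whose arrival leaves only a decreasing stack
  ending in \<open>k\<close>, hence only big letters, and which then separates a decreasing word \<open>W\<close> from these.
\<close>

lemma block_decreasing_if_avoids:
  assumes \<pi>: "\<pi> \<in> permutations_of_set {1..n}" "\<pi> \<noteq> []" "hd \<pi> = k"
    and avoids: "\<not> unsortable_triple (<) (emitted [1, 2, 3] [] \<pi>)"
  shows "block_decreasing k \<pi>"
proof -
  define v where "v = emitted [1, 2, 3] [] \<pi>"
  obtain \<rho> where \<rho>: "\<pi> = k # \<rho>" using \<pi>(2,3) by (cases \<pi>) auto
  have d: "distinct \<pi>" "set \<pi> = {1..n}" using \<pi>(1) by (auto simp: permutations_of_set_def)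
  have v: "distinct v" "set v = {1..n}" using emitted_distinct[OF d(1)] d(2) by (simp_all add: v_def)
  have "v \<noteq> []" "last v = k" using v(2) d(2) last_emitted[of k \<rho>] by (auto simp: v_def \<rho>)
  then obtain v' where v': "v = v' @ [k]" by (metis append_butlast_last_id)
  have "sorted_wrt (>) (filter (\<lambda>y. k < y) v')"
  proof (rule sorted_wrt_before_least)
    have "filter (\<lambda>y. k \<le> y) v = filter (\<lambda>y. k \<le> y) v' @ [k]" by (simp add: v')
    moreover have "filter (\<lambda>y. k \<le> y) v' = filter (\<lambda>y. k < y) v'"
      using v(1) by (intro filter_cong) (auto simp: v' le_less)
    ultimately have "filter (\<lambda>y. k < y) v' @ k # [] = filter (\<lambda>y. k \<le> y) v" by simp
    then show "\<not> unsortable_triple (<) (filter (\<lambda>y. k < y) v' @ k # [])"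
      using unsortable_triple_subseq[OF avoids[folded v_def], of "filter (\<lambda>y. k \<le> y) v"] by simp
  qed (use v in \<open>auto simp: v'\<close>)
  moreover have "filter (\<lambda>y. k \<le> y) v = filter (\<lambda>y. k < y) v' @ [k]"
    using v(1) by (auto simp: v' le_less intro!: filter_cong)
  ultimately have big: "sorted_wrt (>) (filter (\<lambda>y. k \<le> y) v)" by (simp add: sorted_wrt_append)
  have "sorted_wrt (>) (filter (\<lambda>s. s < k) v) \<and>
    (\<forall>s y s'. subseq [s, y, s'] v \<longrightarrow> s < k \<longrightarrow> s' < k \<longrightarrow> y < k)"
  proof (cases "k = 1")
    case True
    have "x \<in> set v \<Longrightarrow> \<not> x < k" for x using v(2) True by auto
    then show ?thesis using subseq_imp_mem[of _ v] by (auto simp: filter_False)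
  next
    case False
    have "k \<in> {1..n}" using d(2) by (auto simp: \<rho>)
    then have "1 \<in> set \<rho>" using d(2) False by (auto simp: \<rho>)
    then obtain p q where pq: "\<rho> = p @ 1 # q" by (meson split_list)
    define st K where "st = stack_after (k # p)" and "K = kept [1, 2, 3] 1 (stack_after (k # p))"
    have st: "st \<noteq> []" "last st = k" using last_stack_after[of k p] by (simp_all add: st_def)
    have K: "K \<noteq> []" "last K = k" using kept_123_nonempty[OF st(1), of 1] st(2) by (simp_all add: K_def st_def)
    have stK: "st = popped [1, 2, 3] 1 st @ K" by (simp add: K_def st_def popped_append_kept)
    have "distinct (k # p)" using d(1) by (simp add: \<rho> pq)
    moreover have "1 < x" if "x \<in> set (k # p)" for x
    proof -
      have "x \<in> set \<pi>" "x \<noteq> 1" using that d(1) by (auto simp: \<rho> pq)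
      then have "x \<in> {1..n}" "x \<noteq> 1" using d(2) by auto
      then show ?thesis by simp
    qed
    ultimately have st': "distinct st" "\<And>x. x \<in> set st \<Longrightarrow> 1 < x"
      using distinct_stack_after[of "k # p"] set_after[of "k # p"] unfolding st_def by auto
    have Kd: "distinct K" "\<And>x. x \<in> set K \<Longrightarrow> 1 < x"
      using st' stK by (metis distinct_append, metis Un_iff set_append)
    have sK: "sorted_wrt (>) K"
      unfolding sorted_wrt_iff_subseq
    proof (intro allI impI)
      fix a b assume ab: "subseq [a, b] K"
      have "\<not> contains_pattern [1, 2, 3] (1 # K)"
        using kept_avoids K(1) unfolding K_def by blast
      then have "\<not> a < b"
        using ab Kd(2)[OF subseq_imp_mem[OF ab, of a]] unfolding contains_123_iff by (metis list.set_intros(1) subseq_Cons2)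
      moreover have "a \<noteq> b" using subseqs_distinctD[of "[a, b]" K] ab Kd(1) by auto
      ultimately show "a > b" by simp
    qed
    have Kk: "k \<le> x" if "x \<in> set K" for x
    proof (cases "x = k")
      case False
      then have "subseq [x, k] K" using subseq_butlast_last[OF K(1) that] K(2) by simp
      then show ?thesis using sK unfolding sorted_wrt_iff_subseq by (meson less_imp_le)
    qed simp
    have "v = output_after (k # p @ [1]) @ emitted [1, 2, 3] ([] @ 1 # K) q"
      using emitted_after[of "k # p @ [1]" q] after_snoc(1)[of "k # p" 1]
      by (simp add: v_def \<rho> pq K_def)
    moreover have "\<exists>W. emitted [1, 2, 3] ([] @ 1 # K) q = W @ 1 # K"
      using d(2) Kd(2) by (intro emitted_bottom[OF sK]) (auto simp: \<rho> pq less_imp_le)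
    ultimately obtain W where W: "v = W @ 1 # K" by (metis append_assoc)
    have W1: "1 < x" if "x \<in> set W" for x
    proof -
      have "x \<in> {1..n}" "x \<noteq> 1" using v that unfolding W by auto
      then show ?thesis by simp
    qed
    have sW: "sorted_wrt (>) W"
      using avoids W1 v(1) unfolding v_def[symmetric] W by (intro sorted_wrt_before_least[of W 1 K]) auto
    have "filter (\<lambda>s. s < k) K = []" using Kk by (auto simp: filter_empty_conv not_less)
    then have "filter (\<lambda>s. s < k) v = filter (\<lambda>s. s < k) W @ filter (\<lambda>s. s < k) [1]"
      by (simp add: W)
    moreover have "sorted_wrt (>) (W @ [1])" using sW W1 by (simp add: sorted_wrt_append)
    then have "sorted_wrt (>) (filter (\<lambda>s. s < k) (W @ [1]))" by (rule sorted_wrt_filter)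
    ultimately have small: "sorted_wrt (>) (filter (\<lambda>s. s < k) v)" by simp
    have "y < k" if sys: "subseq [s, y, s'] v" "s < k" "s' < k" for s y s'
    proof -
      have "s' \<notin> set K" using Kk that(3) by (meson leD)
      moreover have "subseq ([s, y] @ [s']) ((W @ [1]) @ K)" using sys(1) by (simp add: W)
      ultimately have "subseq ([s, y] @ [s']) (W @ [1])"
        by (intro subseq_snoc_drop_right[of "[s, y]" s' "W @ [1]" K])
      moreover have "subseq [s, y] ([s, y] @ [s'])" by simp
      ultimately have "subseq [s, y] (W @ [1])" using subseq_order.order_trans by blast
      then have "y < s" using \<open>sorted_wrt (>) (W @ [1])\<close> unfolding sorted_wrt_iff_subseq by blast
      then show ?thesis using that(2) by simp
    qed
    with small show ?thesis by blast
  qed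
  then show ?thesis
    using d(1) \<pi>(2,3) big unfolding v_def by unfold_locales blast+
qed

text \<open>
  Reading up to and including \<open>Y\<close> pops nothing: in the resulting stack every ascent goes from a small
  letter to a letter of \<open>C\<close>, and no second ascent can follow. From then on only small letters arrive.
\<close>

lemma emitted_block_form:
  assumes k: "1 < k"
    and CY: "C \<noteq> []" "\<forall>y\<in>set C \<union> set Y. k \<le> y" "sorted_wrt (<) (C @ Y)"
    and AB: "sorted_wrt (<) A" "\<forall>s\<in>set A \<union> set B. s < k - 1" "distinct (A @ B)"
  shows "emitted [1, 2, 3] [] (C @ A @ (k - 1) # Y @ B) =
         rev Y @ sort_with (>) [] (A @ (k - 1) # B) @ rev C"
proof -
  define u where "u = C @ A @ (k - 1) # Y"
  have Y: "y < k \<longleftrightarrow> False" if "y \<in> set Y \<union> set C" for y using CY(2) that by (auto simp: not_less)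
  \<comment> \<open>The only ascents in the stack go from a small to a big letter.\<close>
  have "sorted_wrt (\<lambda>a b. a > b \<or> a < k \<and> k \<le> b) (rev u)"
  proof -
    have 1: "sorted_wrt (\<lambda>a b. a > b \<or> a < k \<and> k \<le> b) (rev X)" if "sorted_wrt (<) X" for X
      using that unfolding sorted_wrt_rev by (rule sorted_wrt_mono_rel[rotated]) blast
    have "c < y" if "y \<in> set Y" "c \<in> set C" for c y
      using CY(3) that by (auto simp: sorted_wrt_append)
    moreover have A: "a < k - 1 \<and> a < k" if "a \<in> set A" for a
    proof -
      have "a < k - 1" using AB(2) that by blast
      then show ?thesis by linarith
    qed
    moreover have "a < y" if "a \<in> set A" "y \<in> set Y" for a y
    proof -
      have "k \<le> y" using CY(2) that(2) by blast
      then show ?thesis using A[OF that(1)] by linarith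
    qed
    moreover have "k - 1 < y" if "y \<in> set Y" for y
    proof -
      have "k \<le> y" using CY(2) that by blast
      then show ?thesis using k by linarith
    qed
    moreover have "sorted_wrt (<) C" "sorted_wrt (<) Y" using CY(3) by (auto simp: sorted_wrt_append)
    ultimately show ?thesis
      using 1[of C] 1[of Y] 1[of A] AB(1) CY(2) k
      by (auto simp: u_def sorted_wrt_append)
  qed
  note Q = this[unfolded sorted_wrt_iff_subseq]
  have "\<not> contains_pattern [1, 2, 3] (rev u)"
  proof
    assume "contains_pattern [1, 2, 3] (rev u)"
    then obtain a b c where abc: "subseq [a, b, c] (rev u)" "a < b" "b < c"
      unfolding contains_123_iff by blast
    have "subseq [a, b] [a, b, c]" "subseq [b, c] [a, b, c]" by auto
    then have "subseq [a, b] (rev u)" "subseq [b, c] (rev u)"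
      using abc(1) subseq_order.order_trans by blast+
    then show False using Q abc(2,3) by (metis leD less_asym)
  qed
  then have "emitted [1, 2, 3] [] (u @ B) = emitted [1, 2, 3] (rev Y @ ((k - 1) # rev A) @ rev C) B"
    using emitted_no_pop[of "[1, 2, 3]" u "[]" B] by (simp add: u_def)
  also have "\<dots> = rev Y @ sort_with (>) ((k - 1) # rev A) B @ rev C"
  proof (rule emitted_123_small_covered)
    show "sorted_wrt (>) ((k - 1) # rev A)" "sorted_wrt (>) (rev C)"
      using AB(1,2) CY(3) by (auto simp: sorted_wrt_rev sorted_wrt_append)
    show "distinct (((k - 1) # rev A) @ B)" using AB(2,3) by auto
    show "s < b" if "s \<in> set (((k - 1) # rev A) @ B)" "b \<in> set (rev C)" for s b
    proof -
      have "s \<le> k - 1" "k \<le> b" using that AB(2) CY(2) by (auto simp: less_imp_le)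
      then show ?thesis using k by simp
    qed
  qed (use CY(1) AB(2) in auto)
  also have "sort_with (>) ((k - 1) # rev A) B = sort_with (>) [] ((A @ [k - 1]) @ B)"
    using AB(1,2) by (subst sort_with_no_pop) (auto simp: asymp_on_def sorted_wrt_append sorted_wrt_rev)
  finally show ?thesis by (simp add: u_def)
qed

section \<open>Counting the inputs of the 12-stack\<close>

definition av213 :: "nat \<Rightarrow> nat list set" where
  "av213 m = {\<tau> \<in> permutations_of_set {1..m}. \<not> unsortable_triple (>) \<tau>}"

text \<open>
  The condition \<open>i \<le> m\<close> excludes shorter words, for which \<open>take i\<close> would be the whole word.
\<close>

definition av213_run :: "nat \<Rightarrow> nat \<Rightarrow> nat list set" where
  "av213_run m i = {\<tau> \<in> av213 m. i \<le> m \<and> sorted_wrt (<) (take i \<tau>)}"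

lemma finite_av213: "finite (av213 m)"
  by (simp add: av213_def)

lemma finite_av213_run: "finite (av213_run m i)"
  by (simp add: av213_run_def finite_av213)

text \<open>
  A 213 that uses the new maximum uses it as the letter 3, so it is a descent of \<open>A\<close> followed by \<open>M\<close>.
\<close>

lemma unsortable_triple_insert_max:
  assumes "distinct (A @ B)" "\<And>x. x \<in> set (A @ B) \<Longrightarrow> x < (M :: nat)"
  shows "unsortable_triple (>) (A @ M # B) \<longleftrightarrow> unsortable_triple (>) (A @ B) \<or> \<not> sorted_wrt (<) A"
proof
  assume "unsortable_triple (>) (A @ M # B)"
  then obtain a b c where abc: "subseq [b, c, a] (A @ M # B)" "b < a" "c < b"
    unfolding unsortable_triple_def by blast
  have M: "M \<notin> set A" "M \<notin> set B" using assms(2) by auto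
  have "set [b, c, a] \<subseteq> set (A @ M # B)" using abc(1) by (blast dest: list_emb_set)
  then have le: "a \<le> M" using assms(2) by (auto simp: le_less)
  show "unsortable_triple (>) (A @ B) \<or> \<not> sorted_wrt (<) A"
  proof (cases "a = M")
    case True
    have "subseq ([b, c] @ [M]) ((A @ [M]) @ B)" using abc(1) True by simp
    then have "subseq ([b, c] @ [M]) (A @ [M])" using subseq_snoc_drop_right[of "[b, c]" M "A @ [M]" B] M by blast
    then have "subseq [b, c] A" by (simp only: subseq_append)
    then show ?thesis using abc(3) unfolding sorted_wrt_iff_subseq by (meson less_asym)
  next
    case False
    have "filter (\<lambda>x. x \<noteq> M) A = A" "filter (\<lambda>x. x \<noteq> M) B = B"
      using M by (auto simp: filter_id_conv)
    then have ins: "filter (\<lambda>x. x \<noteq> M) (A @ M # B) = A @ B" by simp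
    from abc(1) have "subseq (filter (\<lambda>x. x \<noteq> M) [b, c, a]) (filter (\<lambda>x. x \<noteq> M) (A @ M # B))"
      by (rule subseq_filter)
    moreover have "filter (\<lambda>x. x \<noteq> M) [b, c, a] = [b, c, a]" using False le abc(2,3) by auto
    ultimately have "subseq [b, c, a] (A @ B)" by (simp only: ins)
    then show ?thesis using abc(2,3) unfolding unsortable_triple_def by metis
  qed
next
  assume "unsortable_triple (>) (A @ B) \<or> \<not> sorted_wrt (<) A"
  then show "unsortable_triple (>) (A @ M # B)"
  proof
    assume "unsortable_triple (>) (A @ B)"
    moreover have "subseq (A @ B) (A @ M # B)" by (simp add: subseq_append' list_emb_Cons)
    ultimately show ?thesis
      unfolding unsortable_triple_def by (meson subseq_order.order_trans)
  next
    assume "\<not> sorted_wrt (<) A"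
    then obtain b c where bc: "subseq [b, c] A" "\<not> b < c" unfolding sorted_wrt_iff_subseq by blast
    moreover have "b \<noteq> c"
      using subseqs_distinctD[of "[b, c]" A] bc(1) assms(1) by auto
    moreover have "subseq ([b, c] @ [M]) (A @ M # B)"
      using bc(1) by (intro list_emb_append_mono) auto
    moreover have "b < M"
      using list_emb_set[OF bc(1), of b] assms(2) by auto
    ultimately show ?thesis unfolding unsortable_triple_def
      by (metis append_Cons append_Nil linorder_neqE_nat)
  qed
qed

lemma insert_max_mem_permutations:
  assumes "M = Suc m"
  shows "A @ M # B \<in> permutations_of_set {1..M} \<longleftrightarrow> A @ B \<in> permutations_of_set {1..m}"
proof -
  have "{1..M} = insert M {1..m}" "M \<notin> {1..m}" using assms by auto
  then show ?thesis unfolding permutations_of_set_def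
    by (auto simp del: atLeastAtMost_iff)
qed

lemma insert_max_mem_av213:
  "A @ Suc m # B \<in> av213 (Suc m) \<longleftrightarrow> A @ B \<in> av213 m \<and> sorted_wrt (<) A"
proof (cases "A @ B \<in> permutations_of_set {1..m}")
  case True
  then have "distinct (A @ B)" "set (A @ B) = {1..m}" by (auto simp: permutations_of_set_def)
  then have "unsortable_triple (>) (A @ Suc m # B) \<longleftrightarrow>
      unsortable_triple (>) (A @ B) \<or> \<not> sorted_wrt (<) A"
    by (intro unsortable_triple_insert_max) auto
  then show ?thesis using True insert_max_mem_permutations[OF refl, of A m B] by (simp add: av213_def)
next
  case False
  then show ?thesis using insert_max_mem_permutations[OF refl, of A m B] by (simp add: av213_def)
qed

lemma length_av213: "\<tau> \<in> av213 m \<Longrightarrow> length \<tau> = m"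
  using length_finite_permutations_of_set by (fastforce simp: av213_def)

definition insert_max :: "nat \<Rightarrow> nat \<Rightarrow> nat list \<Rightarrow> nat list" where
  "insert_max m i \<rho> = take i \<rho> @ Suc m # drop i \<rho>"

text \<open>
  No letter can follow the maximum in an increasing run.
\<close>

lemma not_sorted_beyond_max:
  assumes "A @ M # B \<in> av213 M" "length A + 2 \<le> i" "i \<le> M"
  shows "\<not> sorted_wrt (<) (take i (A @ M # B))"
proof -
  have "length A + length B + 1 = M" using length_av213[OF assms(1)] by simp
  then obtain b B' where B: "B = b # B'" using assms by (cases B) auto
  obtain d where i: "i = length A + Suc (Suc d)" using assms(2) by (metis add_2_eq_Suc' add_Suc_right le_Suc_ex add.assoc Suc_eq_plus1 add_2_eq_Suc)
  have "b \<in> {1..M}" using assms(1) B by (auto simp: av213_def permutations_of_set_def)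
  then show ?thesis by (auto simp: B i sorted_wrt_append)
qed

text \<open>
  In a word that starts with an increasing run of length \<open>i + 1\<close> the maximum has at least \<open>i\<close> letters
  to its left. If it has more, the run is longer; if it has exactly \<open>i\<close>, deleting it gives an
  arbitrary word of length \<open>m\<close> with an increasing run of length \<open>i\<close>.
\<close>

lemma av213_run_Suc:
  assumes "i \<le> m"
  shows "av213_run (Suc m) (Suc i) = av213_run (Suc m) (Suc (Suc i)) \<union> insert_max m i ` av213_run m i"
    (is "?L = ?R1 \<union> ?R2")
proof (intro equalityI subsetI)
  fix \<tau> assume \<tau>: "\<tau> \<in> ?L"
  then have av: "\<tau> \<in> av213 (Suc m)" and run: "sorted_wrt (<) (take (Suc i) \<tau>)"
    by (auto simp: av213_run_def)
  have "Suc m \<in> set \<tau>" using av by (auto simp: av213_def permutations_of_set_def)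
  then obtain A B where AB: "\<tau> = A @ Suc m # B" by (meson split_list)
  then have \<rho>: "A @ B \<in> av213 m" "sorted_wrt (<) A" using av insert_max_mem_av213 by auto
  have len: "length A + length B = m" using length_av213[OF \<rho>(1)] by simp
  have "\<not> length A < i"
    using not_sorted_beyond_max[of A "Suc m" B "Suc i"] av run assms AB by auto
  then consider "length A = i" | "i < length A" by linarith
  then show "\<tau> \<in> ?R1 \<union> ?R2"
  proof cases
    case 1
    then have "\<tau> = insert_max m i (A @ B)" by (simp add: insert_max_def AB)
    moreover have "A @ B \<in> av213_run m i" using \<rho> assms 1 by (simp add: av213_run_def)
    ultimately show ?thesis by blast
  next
    case 2
    have "\<forall>x\<in>set A. x < Suc m"
      using \<rho>(1) by (auto simp: av213_def permutations_of_set_def less_Suc_eq_le)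
    then have "sorted_wrt (<) (A @ [Suc m])" using \<rho>(2) by (simp add: sorted_wrt_append)
    moreover have "take (Suc (Suc i)) \<tau> = take (Suc (Suc i)) (A @ [Suc m])"
    proof -
      have "Suc (Suc i) - length A = 0 \<or> Suc (Suc i) - length A = Suc 0" using 2 by linarith
      then show ?thesis by (auto simp: AB)
    qed
    ultimately have "sorted_wrt (<) (take (Suc (Suc i)) \<tau>)" by (metis sorted_wrt_take)
    moreover have "Suc (Suc i) \<le> Suc m" using 2 len by simp
    ultimately show ?thesis using av by (simp add: av213_run_def)
  qed
next
  fix \<tau> assume "\<tau> \<in> ?R1 \<union> ?R2"
  then show "\<tau> \<in> ?L"
  proof
    assume \<tau>: "\<tau> \<in> ?R1"
    then have "sorted_wrt (<) (take (Suc i) (take (Suc (Suc i)) \<tau>))"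
      by (simp add: av213_run_def sorted_wrt_take del: take_take)
    then show "\<tau> \<in> ?L" using \<tau> by (simp add: av213_run_def min_def)
  next
    assume "\<tau> \<in> ?R2"
    then obtain \<rho> where \<rho>: "\<rho> \<in> av213 m" "sorted_wrt (<) (take i \<rho>)" "\<tau> = insert_max m i \<rho>"
      by (auto simp: av213_run_def)
    have "length \<rho> = m" using \<rho>(1) by (rule length_av213)
    then have "take (Suc i) \<tau> = take i \<rho> @ [Suc m]"
      using assms by (simp add: \<rho>(3) insert_max_def)
    moreover have "\<forall>x\<in>set \<rho>. x < Suc m"
      using \<rho>(1) by (auto simp: av213_def permutations_of_set_def less_Suc_eq_le)
    moreover have "\<tau> \<in> av213 (Suc m)" using \<rho> by (simp add: insert_max_def insert_max_mem_av213)
    ultimately show "\<tau> \<in> ?L" using \<rho>(2) assms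
      by (auto simp: av213_run_def sorted_wrt_append dest: in_set_takeD)
  qed
qed

lemma card_av213_run_Suc:
  assumes "i \<le> m"
  shows "card (av213_run (Suc m) (Suc i)) =
    card (av213_run (Suc m) (Suc (Suc i))) + card (av213_run m i)"
proof -
  have len: "length (take i \<rho>) = i" if "\<rho> \<in> av213_run m i" for \<rho>
    using that assms length_av213 by (auto simp: av213_run_def)
  have "inj_on (insert_max m i) (av213_run m i)"
  proof (rule inj_onI)
    fix \<rho> \<rho>' assume "\<rho> \<in> av213_run m i" "\<rho>' \<in> av213_run m i" "insert_max m i \<rho> = insert_max m i \<rho>'"
    then have "take i \<rho> = take i \<rho>' \<and> drop i \<rho> = drop i \<rho>'"
      using len by (simp add: insert_max_def)
    then show "\<rho> = \<rho>'" by (metis append_take_drop_id)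
  qed
  moreover have "av213_run (Suc m) (Suc (Suc i)) \<inter> insert_max m i ` av213_run m i = {}"
  proof -
    have "insert_max m i \<rho> \<notin> av213_run (Suc m) (Suc (Suc i))" if "\<rho> \<in> av213_run m i" for \<rho>
      using not_sorted_beyond_max[of "take i \<rho>" "Suc m" "drop i \<rho>" "Suc (Suc i)"] len[OF that]
      by (auto simp: av213_run_def insert_max_def)
    then show ?thesis by blast
  qed
  ultimately show ?thesis
    unfolding av213_run_Suc[OF assms]
    by (simp add: card_Un_disjoint finite_av213_run card_image)
qed

text \<open>
  The ballot numbers as a difference of binomial coefficients. The recurrence goes up in the length of
  the word and down in the length of the run, starting from runs longer than the word, where both sides
  are 0; it is Pascal's rule in each of the two terms. A run of length 0 is no restriction compared
  with length 1, which corresponds to the symmetry of the binomial coefficients of odd order.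
\<close>

lemma card_av213_run:
  "i \<le> m \<Longrightarrow> int (card (av213_run m i)) = int ((2 * m - i) choose m) - int ((2 * m - i) choose Suc m)"
proof (induction m arbitrary: i)
  case 0
  have "av213_run 0 0 = {[]}"
    by (auto simp: av213_run_def av213_def unsortable_triple_def)
  with 0 show ?case by simp
next
  case (Suc m)
  have step: "int (card (av213_run (Suc m) (Suc j))) =
      int ((2 * Suc m - Suc j) choose Suc m) - int ((2 * Suc m - Suc j) choose Suc (Suc m))"
    if "j \<le> Suc m" for j
    using that
  proof (induction j rule: inc_induct)
    case base
    show ?case by (simp add: av213_run_def binomial_eq_0)
  next
    case (step j)
    then have j: "j \<le> m" by simp
    \<comment> \<open>Both differences are exact because \<open>j \<le> m\<close>; the upper indices now fit Pascal's rule.\<close>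
    have eq: "2 * Suc m - Suc j = Suc (2 * m - j)" "2 * Suc m - Suc (Suc j) = 2 * m - j"
      using j by auto
    show ?case
      using step.IH Suc.IH[OF j] card_av213_run_Suc[OF j] unfolding eq by simp
  qed
  show ?case
  proof (cases i)
    case 0
    have "sorted_wrt (<) (take (Suc 0) \<tau>)" for \<tau> :: "nat list" by (cases \<tau>) auto
    then have "av213_run (Suc m) 0 = av213_run (Suc m) (Suc 0)" by (simp add: av213_run_def)
    moreover have "2 * Suc m - 0 = Suc (2 * Suc m - Suc 0)" by simp
    moreover have "(2 * Suc m - Suc 0) choose m = (2 * Suc m - Suc 0) choose Suc m"
      using binomial_symmetric[of m "2 * Suc m - Suc 0"] by simp
    ultimately show ?thesis using step[of 0] 0 by (metis (no_types, lifting) add_diff_cancel_left binomial_Suc_Suc le0 of_nat_add)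
  next
    case (Suc j)
    then show ?thesis using step[of j] Suc.prems by simp
  qed
qed

lemma card_av213: "real (card (av213 m)) = catalan m"
proof -
  have "av213 m = av213_run m 0" by (simp add: av213_run_def)
  then have "int (card (av213 m)) = int ((2 * m) choose m) - int ((2 * m) choose Suc m)"
    using card_av213_run[of 0 m] by simp
  then have c: "real (card (av213 m)) = real ((2 * m) choose m) - real ((2 * m) choose Suc m)"
    by (metis of_int_diff of_int_of_nat_eq)
  have "Suc m * ((2 * m) choose Suc m) = 2 * m * ((2 * m - 1) choose m)"
    by (rule binomial_absorption)
  also have "\<dots> = (2 * m - m) * ((2 * m) choose m)"
    by (rule binomial_absorb_comp[symmetric])
  also have "2 * m - m = m" by simp
  finally have "Suc m * ((2 * m) choose Suc m) = m * ((2 * m) choose m)" .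
  then have "real (Suc m) * real ((2 * m) choose Suc m) = real m * real ((2 * m) choose m)"
    by (metis of_nat_mult)
  then show ?thesis unfolding c catalan_def by (simp add: field_simps)
qed

section \<open>The sortable permutations with a given first letter\<close>

text \<open>
  The sortable permutations with first letter \<open>k \<ge> 2\<close> in which \<open>j\<close> is the last big letter before the
  first small one.
\<close>

definition block_perms :: "nat \<Rightarrow> nat \<Rightarrow> nat \<Rightarrow> nat list set" where
  "block_perms n k j = {[k..<j + 1] @ A @ (k - 1) # [j + 1..<n + 1] @ B | A B. A @ (k - 1) # B \<in> av213 (k - 1)}"

lemma max_split_av213:
  assumes "A @ m # B \<in> av213 m" "0 < m"
  shows "sorted_wrt (<) A" "\<forall>s\<in>set A \<union> set B. s < m" "distinct (A @ B)"
    "set A \<union> set B = {1..<m}"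
proof -
  obtain m' where m: "m = Suc m'" using assms(2) by (cases m) auto
  have AB: "A @ B \<in> av213 m'" "sorted_wrt (<) A" using assms(1) insert_max_mem_av213 by (auto simp: m)
  show "sorted_wrt (<) A" by (fact AB(2))
  show "distinct (A @ B)" "set A \<union> set B = {1..<m}"
    using AB(1) by (auto simp: av213_def permutations_of_set_def m atLeastLessThanSuc_atLeastAtMost)
  then show "\<forall>s\<in>set A \<union> set B. s < m" by auto
qed

lemma block_perms_sortable:
  assumes k: "2 \<le> k" "k \<le> j" "j \<le> n" and \<pi>: "\<pi> \<in> block_perms n k j"
  shows "\<pi> \<in> permutations_of_set {1..n} \<and> sortable [1, 2, 3] \<pi> \<and> hd \<pi> = k"
proof -
  obtain A B where AB: "\<pi> = [k..<j + 1] @ A @ (k - 1) # [j + 1..<n + 1] @ B" "A @ (k - 1) # B \<in> av213 (k - 1)"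
    using \<pi> by (auto simp: block_perms_def)
  note m = max_split_av213[OF AB(2)]
  have k1: "0 < k - 1" using k by simp
  have "set \<pi> = ({1..<k - 1} \<union> {k - 1}) \<union> ({k..<j + 1} \<union> {j + 1..<n + 1})"
    using m(4)[OF k1] by (auto simp: AB(1))
  also have "{1..<k - 1} \<union> {k - 1} = {1..<k}" using k by auto
  also have "{k..<j + 1} \<union> {j + 1..<n + 1} = {k..<n + 1}" using k by auto
  also have "{1..<k} \<union> {k..<n + 1} = {1..n}" using k by auto
  finally have s: "set \<pi> = {1..n}" .
  \<comment> \<open>A list with \<open>n\<close> entries and \<open>n\<close> different letters has no repetitions.\<close>
  have "length A + length B + 1 = k - 1" using length_av213[OF AB(2)] by simp
  then have "length \<pi> = card (set \<pi>)" using k unfolding s by (simp add: AB(1))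
  then have "distinct \<pi>" by (simp add: card_distinct)
  with s have perm: "\<pi> \<in> permutations_of_set {1..n}" by (simp add: permutations_of_set_def)
  define D where "D = sort_with (>) [] (A @ (k - 1) # B)"
  have v: "emitted [1, 2, 3] [] \<pi> = rev [j + 1..<n + 1] @ D @ rev [k..<j + 1]"
    unfolding AB(1) D_def
  proof (rule emitted_block_form)
    have "[k..<j + 1] @ [j + 1..<n + 1] = [k..<n + 1]"
      using upt_add_eq_append[of k "j + 1" "n - j"] k by (simp add: add.commute)
    then show "sorted_wrt (<) ([k..<j + 1] @ [j + 1..<n + 1])" by (metis sorted_wrt_upt)
  qed (use k m[OF k1] in auto)
  have D: "sorted_wrt (>) D" "set D = {1..<k - 1} \<union> {k - 1}"
    using AB(2) sort_with_12_decreasing_iff m(4)[OF k1] unfolding D_def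
    by (auto simp: av213_def permutations_of_set_def set_sort_with)
  have Dk: "d < k" if "d \<in> set D" for d using D(2) that k by auto
  have dec: "sorted_wrt (>) (rev [a..<b])" for a b :: nat by (simp only: sorted_wrt_rev sorted_wrt_upt)
  have "\<not> unsortable_triple (<) (D @ rev [k..<j + 1])"
    using Dk by (intro not_unsortable_triple_decreasing_blocks D dec) fastforce
  moreover have "z < x" if "x \<in> set (rev [j + 1..<n + 1])" "z \<in> set (D @ rev [k..<j + 1])" for x z
    using that Dk[of z] k by auto
  ultimately have "\<not> unsortable_triple (<) (emitted [1, 2, 3] [] \<pi>)"
    unfolding v using not_unsortable_triple_decreasing_prefix[OF dec] by blast
  moreover have "hd \<pi> = k" using k by (simp add: AB(1) upt_conv_Cons)
  ultimately show ?thesis using perm sortable_iff[OF perm] by blast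
qed

lemma sortable_imp_block_perms:
  assumes \<pi>: "\<pi> \<in> permutations_of_set {1..n}" "sortable [1, 2, 3] \<pi>" "\<pi> \<noteq> []" "hd \<pi> = k"
    and k: "2 \<le> k"
  shows "\<exists>j\<in>{k..n}. \<pi> \<in> block_perms n k j"
proof -
  have perm: "distinct \<pi>" "set \<pi> = {1..n}" using \<pi>(1) by (auto simp: permutations_of_set_def)
  interpret block_decreasing k \<pi>
    using block_decreasing_if_avoids \<pi> sortable_iff by blast
  have "k \<in> set \<pi>" using \<pi>(3,4) by auto
  then have kn: "k \<le> n" using perm(2) by auto
  then have "k - 1 \<in> set \<pi>" using perm(2) k by auto
  then obtain C A Y B where blocks: "\<pi> = C @ A @ (k - 1) # Y @ B" "C \<noteq> []"
    "\<forall>y\<in>set C \<union> set Y. k \<le> y" "\<forall>s\<in>set A \<union> set B. s < k"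
    "sorted_wrt (<) (C @ Y)" "sorted_wrt (<) A"
    using block_structure k by (metis Suc_1 Suc_le_lessD)
  have mem: "x \<in> set \<pi> \<longleftrightarrow> x \<in> set (C @ Y) \<or> x \<in> set (A @ (k - 1) # B)" for x
    by (auto simp: blocks(1))
  have big: "k \<le> x" if "x \<in> set (C @ Y)" for x using blocks(3) that by simp
  have small: "x < k" if "x \<in> set (A @ (k - 1) # B)" for x
  proof (cases "x = k - 1")
    case False
    then have "x \<in> set A \<union> set B" using that by auto
    then show ?thesis using blocks(4) by blast
  qed (use k in simp)
  have CY_mem: "x \<in> set (C @ Y) \<longleftrightarrow> x \<in> {k..n}" for x
    using mem[of x] big[of x] small[of x] perm(2) k by (metis atLeastAtMost_iff le_trans not_le one_le_numeral)
  have AB_mem: "x \<in> set (A @ (k - 1) # B) \<longleftrightarrow> x \<in> {1..n} \<and> x < k" for x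
    using mem[of x] big[of x] small[of x] perm(2) by (metis not_le)
  have "set (C @ Y) = set [k..<n + 1]" 
    unfolding set_eq_iff CY_mem set_upt atLeastAtMost_iff atLeastLessThan_iff by auto
  then have "C @ Y = [k..<n + 1]"
    using strict_sorted_equal blocks(5) sorted_wrt_upt by blast
  define j where "j = k + length C - 1"
  have "length C + length Y = n + 1 - k"
    using arg_cong[OF \<open>C @ Y = [k..<n + 1]\<close>, of length] by simp
  moreover have "0 < length C" using blocks(2) by simp
  ultimately have j: "k \<le> j" "j \<le> n" "k + length C = j + 1"
    using kn unfolding j_def by linarith+
  have "C = take (length C) [k..<n + 1]" "Y = drop (length C) [k..<n + 1]"
    using \<open>C @ Y = [k..<n + 1]\<close> by (metis append_eq_conv_conj)+
  then have CY: "C = [k..<j + 1]" "Y = [j + 1..<n + 1]"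
    using j by (auto simp: take_upt drop_upt)
  define \<tau> where "\<tau> = A @ (k - 1) # B"
  have "distinct \<tau>" using perm(1) by (auto simp: blocks(1) \<tau>_def)
  have "x \<in> set \<tau> \<longleftrightarrow> x \<in> {1..k - 1}" for x
    using AB_mem[of x] kn k unfolding \<tau>_def by auto
  then have \<tau>: "\<tau> \<in> permutations_of_set {1..k - 1}"
    using \<open>distinct \<tau>\<close> unfolding permutations_of_set_def set_eq_iff by simp
  have AB: "\<forall>s\<in>set A \<union> set B. s < k - 1" "distinct (A @ B)"
  proof -
    have "x < k" "x \<noteq> k - 1" if "x \<in> set A \<union> set B" for x
      using blocks(4) \<open>distinct \<tau>\<close> that by (blast, auto simp: \<tau>_def)
    then have "x < k - 1" if "x \<in> set A \<union> set B" for x using that by fastforce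
    then show "\<forall>s\<in>set A \<union> set B. s < k - 1" by blast
    show "distinct (A @ B)" using \<open>distinct \<tau>\<close> by (auto simp: \<tau>_def)
  qed
  have v: "v = rev Y @ sort_with (>) [] \<tau> @ rev C"
    unfolding blocks(1) \<tau>_def using k by (intro emitted_block_form blocks AB) simp
  have "filter (\<lambda>s. s < k) v = sort_with (>) [] \<tau>"
  proof -
    have "\<forall>s\<in>set (sort_with (>) [] \<tau>). s < k"
      using \<tau> k by (auto simp: set_sort_with permutations_of_set_def)
    moreover have "filter (\<lambda>s. s < k) C = []" "filter (\<lambda>s. s < k) Y = []"
      using blocks(3) by (auto simp: filter_empty_conv not_less)
    ultimately show ?thesis by (simp add: v filter_id_conv flip: rev_filter)
  qed
  then have "\<not> unsortable_triple (>) \<tau>"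
    using small_decreasing sort_with_12_decreasing_iff[OF \<open>distinct \<tau>\<close>] by simp
  then have "\<tau> \<in> av213 (k - 1)" using \<tau> by (simp add: av213_def)
  then have "\<pi> \<in> block_perms n k j"
    unfolding block_perms_def using blocks(1) CY unfolding \<tau>_def by blast
  then show ?thesis using j by auto
qed

text \<open>
  If the first letter is 1, then every letter is big, so nothing is popped and the output is the
  reversed input.
\<close>

lemma sortable_first_one_iff:
  assumes \<pi>: "\<pi> \<in> permutations_of_set {1..n}" "\<pi> \<noteq> []" "hd \<pi> = 1"
  shows "sortable [1, 2, 3] \<pi> \<longleftrightarrow> \<pi> = [1..<n + 1]"
proof
  have perm: "distinct \<pi>" "set \<pi> = {1..n}" using \<pi>(1) by (auto simp: permutations_of_set_def)
  assume "sortable [1, 2, 3] \<pi>"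
  then interpret block_decreasing 1 \<pi>
    using block_decreasing_if_avoids \<pi> sortable_iff by blast
  have "stack_after u = rev u \<and> output_after u = []" if "\<pi> = u @ w" for u w
    using that
  proof (induction u arbitrary: w rule: rev_induct)
    case (snoc x u)
    have "x \<in> {1..n}" using snoc.prems perm(2) by auto
    then have "popped [1, 2, 3] x (stack_after u) = []"
      using snoc.prems by (intro big_pops_nothing[of u "x # w"]) auto
    then show ?case using snoc.IH[of "x # w"] snoc.prems popped_Nil_imp_kept by (simp add: after_snoc)
  qed simp
  from this[of \<pi> "[]"] have "v = rev \<pi>" using emitted_after[of \<pi> "[]"] by simp
  moreover have "filter (\<lambda>y. 1 \<le> y) v = v"
    using emitted_distinct(2)[OF perm(1)] perm(2) by (auto simp: filter_id_conv)
  ultimately have "sorted_wrt (>) (rev \<pi>)" using big_decreasing by simp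
  then have "sorted_wrt (<) \<pi>" by (simp only: sorted_wrt_rev)
  moreover have "set \<pi> = set [1..<n + 1]" unfolding perm(2) set_upt_Suc ..
  ultimately show "\<pi> = [1..<n + 1]" using strict_sorted_equal sorted_wrt_upt by blast
next
  have dec: "sorted_wrt (>) (rev [1..<n + 1])" by (simp only: sorted_wrt_rev sorted_wrt_upt)
  assume eq: "\<pi> = [1..<n + 1]"
  have "\<not> contains_pattern [1, 2, 3] (rev \<pi>)"
  proof
    assume "contains_pattern [1, 2, 3] (rev \<pi>)"
    then obtain a b c where abc: "subseq [a, b, c] (rev \<pi>)" "a < b" "b < c"
      unfolding contains_123_iff by blast
    then have "subseq [b, c] (rev \<pi>)" by (meson subseq_Cons')
    then show False using dec abc(3) unfolding eq sorted_wrt_iff_subseq by (meson less_asym)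
  qed
  then have "emitted [1, 2, 3] [] (\<pi> @ []) = emitted [1, 2, 3] (rev \<pi> @ []) []"
    by (intro emitted_no_pop) simp
  then have "emitted [1, 2, 3] [] \<pi> = rev \<pi>" by simp
  moreover have "\<not> unsortable_triple (<) (rev \<pi>)"
    using not_unsortable_triple_decreasing_prefix[of "rev \<pi>" "[]"] dec
    by (simp add: eq)
  ultimately show "sortable [1, 2, 3] \<pi>" using sortable_iff[OF \<pi>(1)] by simp
qed

lemma filter_small_block:
  assumes "2 \<le> k" "k \<le> j" "A @ (k - 1) # B \<in> av213 (k - 1)"
  shows "filter (\<lambda>s. s < k) ([k..<j + 1] @ A @ (k - 1) # [j + 1..<n + 1] @ B) = A @ (k - 1) # B"
proof -
  have "\<forall>s\<in>set A \<union> set B. s < k - 1" using max_split_av213(2)[OF assms(3)] assms(1) by simp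
  then have "s < k" if "s \<in> set A \<union> set B" for s using that by (meson diff_le_self less_le_trans)
  then have "filter (\<lambda>s. s < k) A = A" "filter (\<lambda>s. s < k) B = B"
    by (simp_all add: filter_id_conv)
  moreover have "filter (\<lambda>s. s < k) [k..<j + 1] = []" "filter (\<lambda>s. s < k) [j + 1..<n + 1] = []"
    using assms(2) by (auto simp: filter_empty_conv)
  ultimately show ?thesis using assms(1) by simp
qed

lemma card_block_perms:
  assumes "2 \<le> k" "k \<le> j"
  shows "finite (block_perms n k j)" "card (block_perms n k j) = card (av213 (k - 1))"
proof -
  have bij: "bij_betw (filter (\<lambda>s. s < k)) (block_perms n k j) (av213 (k - 1))"
    unfolding bij_betw_def
  proof (intro conjI inj_onI equalityI subsetI)
    fix \<pi> \<pi>' assume \<pi>: "\<pi> \<in> block_perms n k j" "\<pi>' \<in> block_perms n k j"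
      and eq: "filter (\<lambda>s. s < k) \<pi> = filter (\<lambda>s. s < k) \<pi>'"
    obtain A B where AB: "\<pi> = [k..<j + 1] @ A @ (k - 1) # [j + 1..<n + 1] @ B" "A @ (k - 1) # B \<in> av213 (k - 1)"
      using \<pi>(1) by (auto simp: block_perms_def)
    obtain A' B' where AB': "\<pi>' = [k..<j + 1] @ A' @ (k - 1) # [j + 1..<n + 1] @ B'" "A' @ (k - 1) # B' \<in> av213 (k - 1)"
      using \<pi>(2) by (auto simp: block_perms_def)
    have "A @ (k - 1) # B = A' @ (k - 1) # B'"
      using eq filter_small_block[OF assms AB(2)] filter_small_block[OF assms AB'(2)]
      unfolding AB(1) AB'(1) by simp
    moreover have "distinct (A @ (k - 1) # B)"
      using AB(2) by (simp add: av213_def permutations_of_set_def)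
    then have "k - 1 \<notin> set A" "k - 1 \<notin> set B" by auto
    ultimately have "A = A'" "B = B'" by (simp_all add: append_Cons_eq_iff)
    then show "\<pi> = \<pi>'" by (simp only: AB(1) AB'(1))
  next
    fix \<tau> assume "\<tau> \<in> filter (\<lambda>s. s < k) ` block_perms n k j"
    then show "\<tau> \<in> av213 (k - 1)"
      unfolding block_perms_def using filter_small_block[OF assms] by fastforce
  next
    fix \<tau> assume \<tau>: "\<tau> \<in> av213 (k - 1)"
    then have "k - 1 \<in> set \<tau>" using assms(1) by (auto simp: av213_def permutations_of_set_def)
    then obtain A B where "\<tau> = A @ (k - 1) # B" by (meson split_list)
    then show "\<tau> \<in> filter (\<lambda>s. s < k) ` block_perms n k j"
      using filter_small_block[OF assms, of A B n] \<tau> unfolding block_perms_def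
      by (intro image_eqI[of _ _ "[k..<j + 1] @ A @ (k - 1) # [j + 1..<n + 1] @ B"]) auto
  qed
  show "card (block_perms n k j) = card (av213 (k - 1))" using bij by (rule bij_betw_same_card)
  show "finite (block_perms n k j)" using bij finite_av213 bij_betw_finite by blast
qed

text \<open>
  The parameters can be read off, so that different parameters give disjoint sets.
\<close>

lemma block_perms_parameters:
  assumes "2 \<le> k" "k \<le> j" "\<pi> \<in> block_perms n k j"
  shows "hd \<pi> = k" "length (takeWhile (\<lambda>y. k \<le> y) \<pi>) = j + 1 - k"
proof -
  obtain A B where AB: "\<pi> = [k..<j + 1] @ A @ (k - 1) # [j + 1..<n + 1] @ B" "A @ (k - 1) # B \<in> av213 (k - 1)"
    using assms(3) by (auto simp: block_perms_def)
  show "hd \<pi> = k" using assms(2) by (simp add: AB(1) upt_conv_Cons)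
  have "\<forall>s\<in>set A \<union> set B. s < k - 1" using max_split_av213(2)[OF AB(2)] assms(1) by simp
  then have "takeWhile (\<lambda>y. k \<le> y) (A @ (k - 1) # [j + 1..<n + 1] @ B) = []"
    using assms(1) by (cases A) auto
  then show "length (takeWhile (\<lambda>y. k \<le> y) \<pi>) = j + 1 - k"
    unfolding AB(1) by (subst takeWhile_append2) (auto simp del: takeWhile.simps)
qed

theorem theorem4p9:
  fixes n :: nat
  assumes "n \<ge> 1"
  shows "real (num_sortable [1, 2, 3] n) =
           1 + (\<Sum>h = 1..n - 1. (real n - real h) * catalan h)"
proof -
  define F where "F = (\<Union>(k, j)\<in>(SIGMA k:{2..n}. {k..n}). block_perms n k j)"
  have set_eq: "{\<pi> \<in> permutations_of_set {1..n}. sortable [1, 2, 3] \<pi>} = insert [1..<n + 1] F"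
  proof (intro equalityI subsetI)
    fix \<pi> assume "\<pi> \<in> {\<pi> \<in> permutations_of_set {1..n}. sortable [1, 2, 3] \<pi>}"
    then have \<pi>: "\<pi> \<in> permutations_of_set {1..n}" "sortable [1, 2, 3] \<pi>" by auto
    then have s: "set \<pi> = {1..n}" by (simp add: permutations_of_set_def)
    then have ne: "\<pi> \<noteq> []" using assms by auto
    then have "hd \<pi> \<in> {1..n}" using s by (metis hd_in_set)
    then consider "hd \<pi> = 1" | "2 \<le> hd \<pi>" "hd \<pi> \<le> n" by fastforce
    then show "\<pi> \<in> insert [1..<n + 1] F"
    proof cases
      case 1
      then show ?thesis using sortable_first_one_iff[OF \<pi>(1) ne] \<pi>(2) by blast
    next
      case 2
      then show ?thesis using sortable_imp_block_perms[OF \<pi> ne refl] by (fastforce simp: F_def)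
    qed
  next
    fix \<pi> assume "\<pi> \<in> insert [1..<n + 1] F"
    then consider "\<pi> = [1..<n + 1]" | k j where "2 \<le> k" "k \<le> j" "j \<le> n" "\<pi> \<in> block_perms n k j"
      by (auto simp: F_def)
    then show "\<pi> \<in> {\<pi> \<in> permutations_of_set {1..n}. sortable [1, 2, 3] \<pi>}"
    proof cases
      case 1
      then have "\<pi> \<in> permutations_of_set {1..n}"
        unfolding permutations_of_set_def using set_upt_Suc by simp
      moreover have "\<pi> \<noteq> []" "hd \<pi> = 1" using assms by (simp_all add: 1 upt_conv_Cons)
      ultimately show ?thesis using sortable_first_one_iff 1 by blast
    next
      case 2
      then show ?thesis using block_perms_sortable by blast
    qed
  qed
  have "card F = (\<Sum>(k, j)\<in>(SIGMA k:{2..n}. {k..n}). card (block_perms n k j))"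
    unfolding F_def
  proof (subst card_UN_disjoint)
    show "\<forall>p\<in>(SIGMA k:{2..n}. {k..n}). \<forall>q\<in>(SIGMA k:{2..n}. {k..n}). p \<noteq> q \<longrightarrow>
        (case p of (k, j) \<Rightarrow> block_perms n k j) \<inter> (case q of (k, j) \<Rightarrow> block_perms n k j) = {}"
    proof (intro ballI impI, rule ccontr)
      fix p q assume pq: "p \<in> (SIGMA k:{2..n}. {k..n})" "q \<in> (SIGMA k:{2..n}. {k..n})" "p \<noteq> q"
        "(case p of (k, j) \<Rightarrow> block_perms n k j) \<inter> (case q of (k, j) \<Rightarrow> block_perms n k j) \<noteq> {}"
      obtain k j k' j' where [simp]: "p = (k, j)" "q = (k', j')" by (cases p, cases q)
      obtain \<pi> where "\<pi> \<in> block_perms n k j" "\<pi> \<in> block_perms n k' j'" using pq(4) by auto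
      then have "k = k'" "j + 1 - k = j' + 1 - k'"
        using block_perms_parameters pq(1,2) by (metis SigmaD1 SigmaD2 \<open>p = (k, j)\<close> \<open>q = (k', j')\<close> atLeastAtMost_iff)+
      then show False using pq(1-3) by auto
    qed
  qed (use card_block_perms in \<open>auto simp: split_beta\<close>)
  also have "\<dots> = (\<Sum>k = 2..n. \<Sum>j = k..n. card (block_perms n k j))"
    by (simp add: sum.Sigma)
  also have "\<dots> = (\<Sum>k = 2..n. (n + 1 - k) * card (av213 (k - 1)))"
    by (intro sum.cong refl) (simp add: card_block_perms Suc_eq_plus1)
  finally have "real (card F) = (\<Sum>k = 2..n. real (n + 1 - k) * catalan (k - 1))"
    by (simp add: card_av213)
  also have "\<dots> = (\<Sum>h = 1..n - 1. real (n - h) * catalan h)"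
    by (rule sum.reindex_bij_witness[of _ "\<lambda>h. h + 1" "\<lambda>k. k - 1"]) (use assms in auto)
  also have "\<dots> = (\<Sum>h = 1..n - 1. (real n - real h) * catalan h)"
    by (intro sum.cong refl) (auto simp: of_nat_diff)
  finally have F: "real (card F) = (\<Sum>h = 1..n - 1. (real n - real h) * catalan h)" .
  have "finite F" using card_block_perms unfolding F_def by (intro finite_UN_I) auto
  moreover have "[1..<n + 1] \<notin> F"
  proof
    assume "[1..<n + 1] \<in> F"
    then obtain k j where "2 \<le> k" "k \<le> j" "[1..<n + 1] \<in> block_perms n k j" by (auto simp: F_def)
    then have "hd [1..<n + 1] = k" using block_perms_parameters by blast
    then show False using \<open>2 \<le> k\<close> assms by (simp add: upt_conv_Cons)
  qed
  ultimately show ?thesis using F by (simp add: num_sortable_def set_eq)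
qed

end
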